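(* For each $n$, let $p_n$ be a probability distribution on the positive integers and let $X_n$ be a random variable with distribution $p_n$, with $\mu_n=E(\log X_n)\in(0,\infty)$. Assume that $$\mu_n=o(\log n)$$ and that, for any fixed $\eta>0$, $$E\left[(\log X_n)\mathbf 1_{\{\log X_n>\eta\log n\}}\right]=o(\mu_n)\quad\text{as } n\to\infty .$$ Then the family $\{(S_n,Q_{n,p_n},U_n)\}_{n\ge1}$ of $p_n$-shuffles has a total variation cutoff with critical time $t_n=\frac{3\log n}{2\mu_n}$.
   Context: Shuffles. $S_n$ is the set of arrangements of a deck of $n$ cards labelled $1,\dots,n$, identified with the symmetric group (an arrangement $\sigma$ lists cards $\sigma(1),\dots,\sigma(n)$ from top to bottom); $U_n$ is the uniform distribution on $S_n$. A rising sequence of $\sigma$ is a maximal set of cards with consecutive face values appearing in increasing order in $\sigma$; $r(\sigma)$ is the number of rising sequences, i.e. $1$ plus the number of $i\in\{1,\dots,n-1\}$ such that card $i+1$ appears before card $i$. For an integer $m\ge1$, an $m$-shuffle cuts the deck into $m$ packs of sizes $(a_1,\dots,a_m)$ with multinomial probability $m^{-n}\frac{n!}{a_1!\cdots a_m!}$, then drops cards one by one, from pack $i$ with probability proportional to its current size. Its distribution $Q_{n,m}$, started from a deck in order, is given by (Bayer–Diaconis) $Q_{n,m}(\sigma)=m^{-n}\binom{n+m-r(\sigma)}{n}$ (the binomial being $0$ if $m<r(\sigma)$), and this may be taken as the definition. For a probability $p$ on $\{1,2,\dots\}$, the $p$-shuffle is $Q_{n,p}=\sum_{m\ge1}p(m)Q_{n,m}$.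 For a probability $Q$ on $S_n$, $Q^k$ is the distribution after $k$ independent successive $Q$-shuffles from a deck in order, i.e. the $k$-fold convolution power of $Q$ on the symmetric group ($Q^0$ is the point mass at the identity). It is known that $Q_{n,m}*Q_{n,m'}=Q_{n,mm'}$. $\|\mu-\nu\|_{\mathrm{TV}}=\sup_{A}\{\mu(A)-\nu(A)\}$. Cutoff. For probabilities $Q_n$ on $S_n$, the family $\{(S_n,Q_n,U_n)\}$ presents a total variation cutoff with critical time $t_n$ (with $0<t_n<\infty$ for all sufficiently large $n$) if for every fixed $\epsilon\in(0,1)$: $\lim_{n\to\infty}\|Q_n^{k_n}-U_n\|_{\mathrm{TV}}=0$ for every sequence of non-negative integers with $k_n>(1+\epsilon)t_n$ for all large $n$, and $\lim_{n\to\infty}\|Q_n^{k_n}-U_n\|_{\mathrm{TV}}=1$ for every sequence of non-negative integers with $k_n<(1-\epsilon)t_n$ for all large $n$. (By group invariance the starting arrangement is irrelevant.) *)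

theory Defs
  imports
    "HOL-Probability.Probability"
    "HOL-Combinatorics.Permutations"
    "HOL-Library.Landau_Symbols"
begin

text \<open>
  An arrangement of \<open>n\<close> cards is a permutation \<open>\<sigma>\<close> of \<open>{1..n}\<close>, where \<open>\<sigma> j\<close> is the card at
  position \<open>j\<close> from the top; thus \<open>inv \<sigma> i\<close> is the position of card \<open>i\<close>. Probabilities on \<open>S n\<close>
  are given by their mass functions; values outside \<open>S n\<close> are never used.
\<close>

definition S :: "nat \<Rightarrow> (nat \<Rightarrow> nat) set" where
  "S n = {\<sigma>. \<sigma> permutes {1..n}}"

definition uniform_mass :: "nat \<Rightarrow> (nat \<Rightarrow> nat) \<Rightarrow> real" where
  "uniform_mass n \<sigma> = 1 / real (card (S n))"

definition rising_sequences :: "nat \<Rightarrow> (nat \<Rightarrow> nat) \<Rightarrow> nat" where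
  "rising_sequences n \<sigma> = 1 + card {i \<in> {1..<n}. inv \<sigma> (i + 1) < inv \<sigma> i}"

text \<open>
  The Bayer--Diaconis formula for the \<open>m\<close>-shuffle, \<open>m \<ge> 1\<close>. For such \<open>m\<close> the subtraction does not
  truncate, since \<open>rising_sequences n \<sigma> \<le> max 1 n\<close>, and for \<open>m < rising_sequences n \<sigma>\<close> the
  binomial coefficient is 0.
\<close>

definition m_shuffle :: "nat \<Rightarrow> nat \<Rightarrow> (nat \<Rightarrow> nat) \<Rightarrow> real" where
  "m_shuffle n m \<sigma> = real ((n + m - rising_sequences n \<sigma>) choose n) / real m ^ n"

definition p_shuffle :: "nat \<Rightarrow> nat pmf \<Rightarrow> (nat \<Rightarrow> nat) \<Rightarrow> real" where
  "p_shuffle n p \<sigma> = (\<Sum>\<^sub>\<infinity>m\<in>{1..}. pmf p m * m_shuffle n m \<sigma>)"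

text \<open>
  Applying the rearrangement \<open>\<pi>\<close> to a deck in arrangement \<open>\<tau>\<close> puts card \<open>\<tau> (\<pi> j)\<close> at position
  \<open>j\<close>, so it yields \<open>\<tau> \<circ> \<pi>\<close>. Hence \<open>convolution n P Q\<close> is the law after a \<open>P\<close>-shuffle followed by
  an independent \<open>Q\<close>-shuffle.
\<close>

definition convolution ::
  "nat \<Rightarrow> ((nat \<Rightarrow> nat) \<Rightarrow> real) \<Rightarrow> ((nat \<Rightarrow> nat) \<Rightarrow> real) \<Rightarrow> (nat \<Rightarrow> nat) \<Rightarrow> real" where
  "convolution n P Q \<rho> = (\<Sum>\<tau>\<in>S n. P \<tau> * Q (inv \<tau> \<circ> \<rho>))"

primrec conv_power ::
  "nat \<Rightarrow> ((nat \<Rightarrow> nat) \<Rightarrow> real) \<Rightarrow> nat \<Rightarrow> (nat \<Rightarrow> nat) \<Rightarrow> real" where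
  "conv_power n Q 0 = (\<lambda>\<sigma>. if \<sigma> = id then 1 else 0)"
| "conv_power n Q (Suc k) = convolution n (conv_power n Q k) Q"

definition tv_norm ::
  "nat \<Rightarrow> ((nat \<Rightarrow> nat) \<Rightarrow> real) \<Rightarrow> ((nat \<Rightarrow> nat) \<Rightarrow> real) \<Rightarrow> real" where
  "tv_norm n P Q = (SUP A\<in>Pow (S n). (\<Sum>\<sigma>\<in>A. P \<sigma>) - (\<Sum>\<sigma>\<in>A. Q \<sigma>))"

definition tv_cutoff :: "(nat \<Rightarrow> (nat \<Rightarrow> nat) \<Rightarrow> real) \<Rightarrow> (nat \<Rightarrow> real) \<Rightarrow> bool" where
  "tv_cutoff Q t \<longleftrightarrow>
     (\<forall>\<^sub>F n in sequentially. 0 < t n) \<and>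
     (\<forall>\<epsilon>. 0 < \<epsilon> \<and> \<epsilon> < 1 \<longrightarrow>
        (\<forall>k :: nat \<Rightarrow> nat. (\<forall>\<^sub>F n in sequentially. (1 + \<epsilon>) * t n < real (k n)) \<longrightarrow>
           (\<lambda>n. tv_norm n (conv_power n (Q n) (k n)) (uniform_mass n)) \<longlonglongrightarrow> 0) \<and>
        (\<forall>k :: nat \<Rightarrow> nat. (\<forall>\<^sub>F n in sequentially. real (k n) < (1 - \<epsilon>) * t n) \<longrightarrow>
           (\<lambda>n. tv_norm n (conv_power n (Q n) (k n)) (uniform_mass n)) \<longlonglongrightarrow> 1))"

end

theory Submission
  imports Defs
begin

text \<open>
  Two facts decide how many \<open>p\<close>-shuffles are needed. An \<open>a\<close>-shuffle followed by a \<open>b\<close>-shuffle is an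
  \<open>(a * b)\<close>-shuffle, so after \<open>k\<close> shuffles the deck has the law of a \<open>Z\<close>-shuffle, where \<open>Z\<close> is the
  product of \<open>k\<close> independent draws from \<open>p\<close> (\<open>conv_power_eq_expectation\<close>). And an \<open>m\<close>-shuffle of
  \<open>n\<close> cards passes from far from uniform to close to uniform around \<open>m = n\<^sup>3\<^sup>/\<^sup>2\<close>. Since \<open>ln Z\<close> is a
  sum of \<open>k\<close> independent terms of mean \<open>\<mu>\<close>, the passage takes place at \<open>k * \<mu> = 3 / 2 * ln n\<close>, as long
  as \<open>ln Z\<close> deviates from its mean by \<open>o(ln n)\<close> only.

  The multiplication rule comes from the inverse shuffle. Give every position of the deck a letter
  below \<open>m\<close> and sort the positions stably by their letters. The number of words that lead to a given
  arrangement is the binomial coefficient in the Bayer--Diaconis formula (\<open>card_words_of_rank\<close>), and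
  sorting stably by one key and then by another is the same as sorting lexicographically by pairs of
  letters (\<open>card_words_of_rank_mult\<close>).

  For the threshold \<open>n\<^sup>3\<^sup>/\<^sup>2\<close>, let \<open>r\<close> be the number of rising sequences and \<open>h = (n + 1) / 2 - r\<close>. The
  density of the \<open>m\<close>-shuffle with respect to the uniform law is the product of the factors
  \<open>1 + (j - r) / m\<close> for \<open>j = 1, \<dots>, n\<close>, whose logarithm is \<open>n * h / m\<close> minus a term of order
  \<open>n\<^sup>3 / m\<^sup>2\<close>. Under the uniform law \<open>h\<close> has size at most about \<open>sqrt n\<close>
  (\<open>centred_deficit_second_moment\<close>). If \<open>m\<close> is much larger than \<open>n\<^sup>3\<^sup>/\<^sup>2\<close>, both terms are small and the
  density is nearly \<open>1\<close> (\<open>m_shuffle_excess_le\<close>). If \<open>m\<close> is much smaller, the negative term wins as long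
  as \<open>h\<close> stays below a threshold of order \<open>n\<^sup>2 / m\<close>, which exceeds \<open>sqrt n\<close> by far. So the event that
  \<open>h\<close> exceeds this threshold has probability near \<open>1\<close> for the shuffle and near \<open>0\<close> for the uniform
  law. One event serves for all small \<open>m\<close> at once (\<open>m_shuffle_small_deficit\<close>,
  \<open>uniform_large_deficit\<close>), and therefore also for a mixture.

  The deviations of \<open>ln Z\<close> are controlled by exponential moments, which factorise along the recursive
  definition of the law of \<open>Z\<close>. The tail condition on \<open>p\<close> allows cutting the draws off at
  \<open>ln X \<le> \<eta> * ln n\<close> for arbitrarily small \<open>\<eta>\<close>. For the cut-off draws an exponential moment at rate
  \<open>\<kappa> / ln n\<close> agrees with its linear part up to a relative error \<open>\<kappa> * \<eta>\<close>, so \<open>\<kappa>\<close> may be taken large.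
\<close>

section \<open>Words and their stable ranks\<close>

definition words :: "nat \<Rightarrow> nat \<Rightarrow> (nat \<Rightarrow> nat) set" where
  "words n m = {1..n} \<rightarrow>\<^sub>E {..<m}"

text \<open>
  The value \<open>\<sigma> i\<close> is the rank of position \<open>i\<close> when the positions are sorted by their letters and equal
  letters keep their order. If \<open>w i\<close> is the pack that the card at position \<open>i\<close> was dropped from, then
  \<open>\<sigma>\<close> is the arrangement after the shuffle, because each pack keeps its cards in order.
\<close>

definition stable_rank :: "nat \<Rightarrow> (nat \<Rightarrow> nat) \<Rightarrow> (nat \<Rightarrow> nat) \<Rightarrow> bool" where
  "stable_rank n w \<sigma> \<longleftrightarrow>
     (\<forall>i\<in>{1..n}. \<forall>j\<in>{1..n}. \<sigma> i < \<sigma> j \<longleftrightarrow> w i < w j \<or> w i = w j \<and> i < j)"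

definition words_of_rank :: "nat \<Rightarrow> nat \<Rightarrow> (nat \<Rightarrow> nat) \<Rightarrow> (nat \<Rightarrow> nat) set" where
  "words_of_rank n m \<sigma> = {w \<in> words n m. stable_rank n w \<sigma>}"

lemma finite_S [simp]: "finite (S n)"
  by (simp add: S_def finite_permutations)

lemma card_S [simp]: "card (S n) = fact n"
  by (simp add: S_def card_permutations)

lemma finite_words [simp]: "finite (words n m)"
  by (auto simp: words_def intro: finite_PiE)

lemma card_words [simp]: "card (words n m) = m ^ n"
  by (simp add: words_def card_PiE)

lemma finite_words_of_rank [simp]: "finite (words_of_rank n m \<sigma>)"
  by (simp add: words_of_rank_def)

text \<open>
  A permutation is determined by how it orders its values, which gives the uniqueness of ranks below.
\<close>

lemma permutation_value_eq_card:
  assumes "\<sigma> \<in> S n" "i \<in> {1..n}"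
  shows "\<sigma> i = card {j \<in> {1..n}. \<sigma> j \<le> \<sigma> i}"
proof -
  have p: "\<sigma> permutes {1..n}" using assms by (simp add: S_def)
  have i: "\<sigma> i \<in> {1..n}" using permutes_in_image[OF p] assms by blast
  have "\<sigma> ` {j \<in> {1..n}. \<sigma> j \<le> \<sigma> i} = {1..\<sigma> i}"
  proof (intro equalityI subsetI)
    fix x assume "x \<in> \<sigma> ` {j \<in> {1..n}. \<sigma> j \<le> \<sigma> i}"
    then show "x \<in> {1..\<sigma> i}" using permutes_in_image[OF p] by fastforce
  next
    fix x assume x: "x \<in> {1..\<sigma> i}"
    then have "x \<in> {1..n}" using i by auto
    then obtain j where "j \<in> {1..n}" "x = \<sigma> j" using permutes_image[OF p] by blast
    then show "x \<in> \<sigma> ` {j \<in> {1..n}. \<sigma> j \<le> \<sigma> i}" using x by auto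
  qed
  then show ?thesis
    using card_image[of \<sigma> "{j \<in> {1..n}. \<sigma> j \<le> \<sigma> i}"] permutes_inj_on[OF p]
    by (metis card_atLeastAtMost diff_Suc_1)
qed

text \<open>
  Pairs of a letter and its position are distinct and linearly ordered lexicographically, so counting
  the pairs up to a given one enumerates the positions.
\<close>

lemma ex1_stable_rank: "\<exists>!\<sigma>. \<sigma> \<in> S n \<and> stable_rank n w \<sigma>"
proof (rule ex_ex1I)
  \<comment> \<open>The strict lexicographic order on pairs of a letter and its position.\<close>
  define less where "less i j \<longleftrightarrow> w i < w j \<or> w i = w j \<and> i < j" for i j
  define below where "below i = {j \<in> {1..n}. less j i \<or> j = i}" for i
  define \<sigma> where "\<sigma> i = (if i \<in> {1..n} then card (below i) else i)" for i
  have fin: "finite (below i)" for i by (simp add: below_def)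
  have strict: "card (below i) < card (below j)" if "less i j" "j \<in> {1..n}" for i j
  proof (rule psubset_card_mono[OF fin])
    have "j \<in> below j" "j \<notin> below i" using that by (auto simp: below_def less_def)
    moreover have "below i \<subseteq> below j" using that by (auto simp: below_def less_def)
    ultimately show "below i \<subset> below j" by blast
  qed
  have total: "less i j \<or> i = j \<or> less j i" for i j by (auto simp: less_def)
  have irr: "\<sigma> i < \<sigma> j \<longleftrightarrow> less i j" if "i \<in> {1..n}" "j \<in> {1..n}" for i j
    using strict[of i j] strict[of j i] total[of i j] that by (auto simp: \<sigma>_def)
  have inj: "inj_on \<sigma> {1..n}"
  proof (rule inj_onI)
    fix i j assume ij: "i \<in> {1..n}" "j \<in> {1..n}" "\<sigma> i = \<sigma> j"
    then show "i = j" using irr[of i j] irr[of j i] total[of i j] by auto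
  qed
  have "\<sigma> i \<in> {1..n}" if "i \<in> {1..n}" for i
  proof -
    have "i \<in> below i" using that by (simp add: below_def)
    then have "card (below i) > 0" using fin card_gt_0_iff by blast
    moreover have "card (below i) \<le> card {1..n}" by (rule card_mono) (auto simp: below_def)
    ultimately show ?thesis using that by (simp add: \<sigma>_def)
  qed
  then have "\<sigma> ` {1..n} = {1..n}" by (intro endo_inj_surj[OF _ _ inj]) auto
  then have "\<sigma> permutes {1..n}"
    using inj by (intro bij_imp_permutes) (auto simp: bij_betw_def \<sigma>_def)
  then show "\<exists>\<sigma>. \<sigma> \<in> S n \<and> stable_rank n w \<sigma>"
    using irr by (intro exI[of _ \<sigma>]) (auto simp: S_def stable_rank_def less_def)
next
  fix \<sigma> \<tau> assume a: "\<sigma> \<in> S n \<and> stable_rank n w \<sigma>" "\<tau> \<in> S n \<and> stable_rank n w \<tau>"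
  have le: "\<sigma> j \<le> \<sigma> i \<longleftrightarrow> \<tau> j \<le> \<tau> i" if "i \<in> {1..n}" "j \<in> {1..n}" for i j
    using a that unfolding stable_rank_def by (meson not_le)
  show "\<sigma> = \<tau>"
  proof
    fix i show "\<sigma> i = \<tau> i"
    proof (cases "i \<in> {1..n}")
      case True
      have "{j \<in> {1..n}. \<sigma> j \<le> \<sigma> i} = {j \<in> {1..n}. \<tau> j \<le> \<tau> i}" using le True by blast
      then show ?thesis using permutation_value_eq_card a True by metis
    next
      case False
      then show ?thesis using a unfolding S_def by (metis mem_Collect_eq permutes_not_in)
    qed
  qed
qed

text \<open>
  The key is kept abstract because the count is used twice: for the words themselves, and for words
  over pairs of letters with the second letter as the key.
\<close>

lemma card_partition_by_rank:
  assumes "finite A"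
  shows "card A = (\<Sum>\<sigma>\<in>S n. card {u \<in> A. stable_rank n (key u) \<sigma>})"
proof -
  have "card A = card (\<Union>\<sigma>\<in>S n. {u \<in> A. stable_rank n (key u) \<sigma>})"
    using ex1_stable_rank by (intro arg_cong[where f = card]) blast
  also have "\<dots> = (\<Sum>\<sigma>\<in>S n. card {u \<in> A. stable_rank n (key u) \<sigma>})"
    using assms ex1_stable_rank by (intro card_UN_disjoint) auto
  finally show ?thesis .
qed

lemma sum_card_words_of_rank: "(\<Sum>\<sigma>\<in>S n. card (words_of_rank n m \<sigma>)) = m ^ n"
  using card_partition_by_rank[of "words n m" n "\<lambda>w. w"] by (simp add: words_of_rank_def)

text \<open>
  These are the words of a fixed rank once their letters are listed in increasing order: weakly
  increasing, with a jump forced wherever \<open>d\<close> is \<open>1\<close>.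
\<close>

definition spaced_words :: "(nat \<Rightarrow> nat) \<Rightarrow> nat \<Rightarrow> nat \<Rightarrow> (nat \<Rightarrow> nat) set" where
  "spaced_words d n m = {a \<in> words n m. \<forall>i\<in>{1..<n}. a i + d i \<le> a (Suc i)}"

lemma spaced_words_mono:
  assumes "a \<in> spaced_words d n m" "1 \<le> i" "i \<le> j" "j \<le> n"
  shows "a i \<le> a j"
  using assms(3,4)
proof (induction j rule: dec_induct)
  case (step j)
  then have "a j + d j \<le> a (Suc j)" using assms(1,2) by (auto simp: spaced_words_def)
  then show ?case using step by simp
qed simp

text \<open>
  A word over \<open>m + 1\<close> letters either avoids the largest letter or ends in it. In the second case,
  deleting the last letter leaves a word that stays \<open>d n\<close> below \<open>m\<close>; a word of length one has no
  predecessor to keep apart, whence the case distinction.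
\<close>

lemma spaced_words_Suc_Suc:
  assumes d: "d n \<le> 1"
  shows "spaced_words d (Suc n) (Suc m) =
    spaced_words d (Suc n) m \<union> (\<lambda>a. a(Suc n := m)) ` spaced_words d n (Suc m - (if n = 0 then 0 else d n))"
    (is "?L = ?A \<union> ?B")
proof (intro equalityI subsetI)
  fix a assume a: "a \<in> ?L"
  show "a \<in> ?A \<union> ?B"
  proof (cases "a (Suc n) = m")
    case False
    have "a i < m" if "i \<in> {1..Suc n}" for i
    proof -
      have "a i \<le> a (Suc n)" using spaced_words_mono[OF a, of i "Suc n"] that by auto
      moreover have "a (Suc n) < Suc m" using a by (auto simp: spaced_words_def words_def)
      ultimately show ?thesis using False by simp
    qed
    then have "a \<in> ?A" using a by (auto simp: spaced_words_def words_def PiE_iff)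
    then show ?thesis ..
  next
    case True
    define b where "b = a(Suc n := undefined)"
    have "b i < Suc m - (if n = 0 then 0 else d n)" if "i \<in> {1..n}" for i
    proof -
      have "a i \<le> a n" using spaced_words_mono[OF a, of i n] that by auto
      moreover have "a n + d n \<le> m" using a that True by (auto simp: spaced_words_def)
      ultimately show ?thesis using that by (simp add: b_def)
    qed
    then have "b \<in> spaced_words d n (Suc m - (if n = 0 then 0 else d n))"
      using a by (auto simp: spaced_words_def words_def PiE_iff b_def extensional_def)
    moreover have "a = b(Suc n := m)" using True by (auto simp: b_def)
    ultimately show ?thesis by blast
  qed
next
  fix a assume "a \<in> ?A \<union> ?B"
  then show "a \<in> ?L"
  proof
    assume "a \<in> ?A"
    then show ?thesis by (fastforce simp: spaced_words_def words_def PiE_iff)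
  next
    assume "a \<in> ?B"
    then obtain b where b: "b \<in> spaced_words d n (Suc m - (if n = 0 then 0 else d n))"
      "a = b(Suc n := m)" by blast
    have lt: "b i < Suc m - d n" if "i \<in> {1..n}" for i
      using b(1) that by (auto simp: spaced_words_def words_def PiE_iff)
    show ?thesis
      unfolding spaced_words_def words_def
    proof (intro CollectI conjI ballI)
      show "a \<in> {1..Suc n} \<rightarrow>\<^sub>E {..<Suc m}"
        using b lt by (fastforce simp: spaced_words_def words_def PiE_iff extensional_def)
      fix i assume i: "i \<in> {1..<Suc n}"
      show "a i + d i \<le> a (Suc i)"
        using i b lt[of n] by (cases "i = n") (auto simp: spaced_words_def)
    qed
  qed
qed

text \<open>
  The two cases of the previous lemma are the two terms of Pascal's rule.
\<close>

lemma card_spaced_words: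
  assumes "\<And>i. d i \<le> 1"
  shows "card (spaced_words d n m) = (n + m - 1 - (\<Sum>i\<in>{1..<n}. d i)) choose n"
proof (induction n arbitrary: m)
  case 0
  have "spaced_words d 0 m = {\<lambda>_. undefined}" by (auto simp: spaced_words_def words_def)
  then show ?case by simp
next
  case (Suc n)
  define e where "e = (if n = 0 then 0 else d n)"
  define D where "D = (\<Sum>i\<in>{1..<n}. d i)"
  have e: "e \<le> 1" using assms by (simp add: e_def)
  have "D \<le> (\<Sum>i\<in>{1..<n}. 1)" unfolding D_def using assms by (intro sum_mono)
  then have D: "D \<le> n - 1" by simp
  have De: "(\<Sum>i\<in>{1..<Suc n}. d i) = D + e"
    by (cases n) (auto simp: D_def e_def)
  have en: "D + e \<le> n" using e D by (cases n) (auto simp: e_def)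
  have "card (spaced_words d (Suc n) m) = (n + m - (D + e)) choose Suc n" for m
  proof (induction m)
    case 0
    have "spaced_words d (Suc n) 0 = {}" by (auto simp: spaced_words_def words_def PiE_iff)
    then show ?case by simp
  next
    case (Suc m)
    have inj: "inj_on (\<lambda>a. a(Suc n := m)) (spaced_words d n (Suc m - e))"
    proof (rule inj_onI)
      fix a b assume ab: "a \<in> spaced_words d n (Suc m - e)" "b \<in> spaced_words d n (Suc m - e)"
        "a(Suc n := m) = b(Suc n := m)"
      have "a (Suc n) = b (Suc n)"
        using ab(1,2) by (auto simp: spaced_words_def words_def PiE_iff extensional_def)
      then show "a = b" using ab(3) by (metis fun_upd_triv fun_upd_upd)
    qed
    have disj: "spaced_words d (Suc n) m \<inter> (\<lambda>a. a(Suc n := m)) ` spaced_words d n (Suc m - e) = {}"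
    proof -
      have "a (Suc n) < m" if "a \<in> spaced_words d (Suc n) m" for a
        using that by (auto simp: spaced_words_def words_def PiE_iff)
      then show ?thesis by fastforce
    qed
    have fin: "finite (spaced_words d n k)" for n k by (simp add: spaced_words_def)
    have "card (spaced_words d (Suc n) (Suc m)) =
        card (spaced_words d (Suc n) m) + card (spaced_words d n (Suc m - e))"
      using spaced_words_Suc_Suc[of d n m] assms disj
      by (simp add: card_Un_disjoint fin card_image[OF inj] flip: e_def)
    also have "card (spaced_words d n (Suc m - e)) = (n + m - (D + e)) choose n"
      using Suc.prems \<open>\<And>m. card (spaced_words d n m) = _\<close>[of "Suc m - e"] e
      by (simp add: D_def algebra_simps)
    also have "card (spaced_words d (Suc n) m) + ((n + m - (D + e)) choose n) = (n + Suc m - (D + e)) choose Suc n"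
      using Suc.IH en by (simp add: Suc_diff_le)
    finally show ?case .
  qed
  then show ?case using De by simp
qed


text \<open>
  This is the Bayer--Diaconis formula. Listing the letters in sorted order, as \<open>w \<circ> inv \<sigma>\<close>, gives a
  weakly increasing word. Neighbouring letters \<open>i\<close> and \<open>i + 1\<close> may be equal only if stability puts
  them in the order of their positions, so a jump is forced at each \<open>i\<close> such that card \<open>i + 1\<close> lies above
  card \<open>i\<close>.
\<close>

lemma card_words_of_rank:
  assumes \<sigma>: "\<sigma> \<in> S n"
  shows "card (words_of_rank n m \<sigma>) = (n + m - rising_sequences n \<sigma>) choose n"
proof -
  define d :: "nat \<Rightarrow> nat" where "d i = (if inv \<sigma> (i + 1) < inv \<sigma> i then 1 else 0)" for i
  have p: "\<sigma> permutes {1..n}" using \<sigma> by (simp add: S_def)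
  note q = permutes_inv[OF p]
  have in1: "\<sigma> i \<in> {1..n} \<longleftrightarrow> i \<in> {1..n}" "inv \<sigma> i \<in> {1..n} \<longleftrightarrow> i \<in> {1..n}" for i
    using permutes_in_image[OF p] permutes_in_image[OF q] by auto
  have inv: "inv \<sigma> (\<sigma> i) = i" "\<sigma> (inv \<sigma> i) = i" for i
    using permutes_inverses[OF p] by auto
  have spaced: "a k < a l \<or> a k = a l \<and> inv \<sigma> k < inv \<sigma> l"
    if a: "a \<in> spaced_words d n m" and kl: "1 \<le> k" "Suc k \<le> l" "l \<le> n" for a k l
  proof -
    have step: "a i < a (Suc i) \<or> a i = a (Suc i) \<and> inv \<sigma> i < inv \<sigma> (Suc i)"
      if "1 \<le> i" "i < n" for i
    proof -
      have "a i + d i \<le> a (Suc i)" using a that by (auto simp: spaced_words_def)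
      moreover have "inv \<sigma> i \<noteq> inv \<sigma> (Suc i)"
        by (simp add: inj_eq[OF permutes_inj[OF q]])
      ultimately show ?thesis by (auto simp: d_def split: if_splits)
    qed
    show ?thesis
      using kl(2,3)
    proof (induction l rule: dec_induct)
      case base
      then show ?case using step kl(1) by auto
    next
      case (step l)
      then show ?case using \<open>\<And>i. 1 \<le> i \<Longrightarrow> i < n \<Longrightarrow> _ i\<close>[of l] kl(1) by auto
    qed
  qed
  have "bij_betw (\<lambda>w. restrict (w \<circ> inv \<sigma>) {1..n}) (words_of_rank n m \<sigma>) (spaced_words d n m)"
  proof (rule bij_betw_byWitness[where f' = "\<lambda>a. restrict (a \<circ> \<sigma>) {1..n}"])
    show "\<forall>w\<in>words_of_rank n m \<sigma>.
        restrict (restrict (w \<circ> inv \<sigma>) {1..n} \<circ> \<sigma>) {1..n} = w"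
      using in1 inv by (auto simp: words_of_rank_def words_def PiE_iff extensional_def fun_eq_iff)
    show "\<forall>a\<in>spaced_words d n m.
        restrict (restrict (a \<circ> \<sigma>) {1..n} \<circ> inv \<sigma>) {1..n} = a"
      using in1 inv by (auto simp: spaced_words_def words_def PiE_iff extensional_def fun_eq_iff)
    show "(\<lambda>w. restrict (w \<circ> inv \<sigma>) {1..n}) ` words_of_rank n m \<sigma> \<subseteq> spaced_words d n m"
    proof clarify
      fix w assume w: "w \<in> words_of_rank n m \<sigma>"
      show "restrict (w \<circ> inv \<sigma>) {1..n} \<in> spaced_words d n m"
        unfolding spaced_words_def
      proof (intro CollectI conjI ballI)
        show "restrict (w \<circ> inv \<sigma>) {1..n} \<in> words n m"
          using w in1(2) by (auto simp: words_of_rank_def words_def PiE_iff)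
        fix i assume i: "i \<in> {1..<n}"
        then have "\<sigma> (inv \<sigma> i) < \<sigma> (inv \<sigma> (Suc i)) \<longleftrightarrow> w (inv \<sigma> i) < w (inv \<sigma> (Suc i)) \<or>
            w (inv \<sigma> i) = w (inv \<sigma> (Suc i)) \<and> inv \<sigma> i < inv \<sigma> (Suc i)"
          using w in1(2)[of i] in1(2)[of "Suc i"] unfolding words_of_rank_def stable_rank_def by auto
        then show "restrict (w \<circ> inv \<sigma>) {1..n} i + d i \<le> restrict (w \<circ> inv \<sigma>) {1..n} (Suc i)"
          using i by (auto simp: inv d_def)
      qed
    qed
    show "(\<lambda>a. restrict (a \<circ> \<sigma>) {1..n}) ` spaced_words d n m \<subseteq> words_of_rank n m \<sigma>"
    proof clarify
      fix a assume a: "a \<in> spaced_words d n m"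
      show "restrict (a \<circ> \<sigma>) {1..n} \<in> words_of_rank n m \<sigma>"
        unfolding words_of_rank_def stable_rank_def
      proof (intro CollectI conjI ballI)
        show "restrict (a \<circ> \<sigma>) {1..n} \<in> words n m"
          using a in1(1) by (auto simp: spaced_words_def words_def PiE_iff)
        fix i j assume ij: "i \<in> {1..n}" "j \<in> {1..n}"
        have "\<sigma> i = \<sigma> j \<longleftrightarrow> i = j" by (simp add: inj_eq[OF permutes_inj[OF p]])
        then show "\<sigma> i < \<sigma> j \<longleftrightarrow> restrict (a \<circ> \<sigma>) {1..n} i < restrict (a \<circ> \<sigma>) {1..n} j \<or>
            restrict (a \<circ> \<sigma>) {1..n} i = restrict (a \<circ> \<sigma>) {1..n} j \<and> i < j"
          using spaced[OF a, of "\<sigma> i" "\<sigma> j"] spaced[OF a, of "\<sigma> j" "\<sigma> i"] ij in1(1)[of i] in1(1)[of j]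
          by (cases "\<sigma> i" "\<sigma> j" rule: linorder_cases) (auto simp: inv)
      qed
    qed
  qed
  then have "card (words_of_rank n m \<sigma>) = card (spaced_words d n m)"
    by (rule bij_betw_same_card)
  also have "\<dots> = (n + m - 1 - (\<Sum>i\<in>{1..<n}. d i)) choose n"
    by (rule card_spaced_words) (simp add: d_def)
  also have "(\<Sum>i\<in>{1..<n}. d i) = card {i \<in> {1..<n}. inv \<sigma> (i + 1) < inv \<sigma> i}"
    by (simp add: d_def flip: sum.inter_filter card_eq_sum)
  finally show ?thesis by (simp add: rising_sequences_def)
qed

text \<open>
  Sorting stably by \<open>g\<close> and then stably by \<open>f\<close> is sorting by \<open>f\<close> with ties broken by \<open>g\<close>. The letters
  of \<open>f\<close> sit at the positions reached after the first sort, hence \<open>f (\<pi> i)\<close>.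
\<close>

lemma stable_rank_lexicographic:
  assumes \<pi>: "\<pi> \<in> S n" and g: "stable_rank n g \<pi>"
    and u: "\<And>i j. i \<in> {1..n} \<Longrightarrow> j \<in> {1..n} \<Longrightarrow>
      (u i < u j \<longleftrightarrow> f (\<pi> i) < f (\<pi> j) \<or> f (\<pi> i) = f (\<pi> j) \<and> g i < g j) \<and>
      (u i = u j \<longleftrightarrow> f (\<pi> i) = f (\<pi> j) \<and> g i = g j)"
  shows "stable_rank n u (\<tau> \<circ> \<pi>) \<longleftrightarrow> stable_rank n f \<tau>"
proof -
  have p: "\<pi> permutes {1..n}" using \<pi> by (simp add: S_def)
  have "stable_rank n f \<tau> \<longleftrightarrow> (\<forall>i\<in>\<pi> ` {1..n}. \<forall>j\<in>\<pi> ` {1..n}. \<tau> i < \<tau> j \<longleftrightarrow> f i < f j \<or> f i = f j \<and> i < j)"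
    unfolding stable_rank_def permutes_image[OF p] ..
  also have "\<dots> \<longleftrightarrow> (\<forall>i\<in>{1..n}. \<forall>j\<in>{1..n}. \<tau> (\<pi> i) < \<tau> (\<pi> j) \<longleftrightarrow>
      f (\<pi> i) < f (\<pi> j) \<or> f (\<pi> i) = f (\<pi> j) \<and> \<pi> i < \<pi> j)" by blast
  also have "\<dots> \<longleftrightarrow> stable_rank n u (\<tau> \<circ> \<pi>)"
    unfolding stable_rank_def o_def
  proof (intro ball_cong refl)
    fix i j assume ij: "i \<in> {1..n}" "j \<in> {1..n}"
    have "\<pi> i < \<pi> j \<longleftrightarrow> g i < g j \<or> g i = g j \<and> i < j" using g ij by (simp add: stable_rank_def)
    then show "(\<tau> (\<pi> i) < \<tau> (\<pi> j) \<longleftrightarrow> f (\<pi> i) < f (\<pi> j) \<or> f (\<pi> i) = f (\<pi> j) \<and> \<pi> i < \<pi> j) \<longleftrightarrow>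
      (\<tau> (\<pi> i) < \<tau> (\<pi> j) \<longleftrightarrow> u i < u j \<or> u i = u j \<and> i < j)"
      using u[OF ij] by metis
  qed
  finally show ?thesis by simp
qed

lemma mult_add_less_iff_lex:
  fixes a b c d m :: nat
  assumes "c < m" "d < m"
  shows "a * m + c < b * m + d \<longleftrightarrow> a < b \<or> a = b \<and> c < d"
    and "a * m + c = b * m + d \<longleftrightarrow> a = b \<and> c = d"
proof -
  have less: "a * m + c < b * m + d" if "a < b" "c < m" for a b c d :: nat
  proof -
    have "a * m + c < Suc a * m" using that by simp
    also have "\<dots> \<le> b * m" using that by (intro mult_le_mono1) simp
    finally show ?thesis by simp
  qed
  show "a * m + c < b * m + d \<longleftrightarrow> a < b \<or> a = b \<and> c < d"
    "a * m + c = b * m + d \<longleftrightarrow> a = b \<and> c = d"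
    using less[of a b c d] less[of b a d c] assms
    by (cases a b rule: linorder_cases; force)+
qed

text \<open>
  A letter below \<open>m * m'\<close> is a pair: its quotient and its remainder modulo \<open>m'\<close>. The remainders alone
  have some rank \<open>\<pi>\<close>, and the quotients, moved along \<open>\<pi>\<close>, then have rank \<open>\<rho> \<circ> inv \<pi>\<close>.
\<close>

lemma card_words_of_rank_mult:
  assumes \<rho>: "\<rho> \<in> S n"
  shows "card (words_of_rank n (m * m') \<rho>) =
    (\<Sum>\<tau>\<in>S n. card (words_of_rank n m \<tau>) * card (words_of_rank n m' (inv \<tau> \<circ> \<rho>)))"
proof -
  have r: "\<rho> permutes {1..n}" using \<rho> by (simp add: S_def)
  have fibre: "card {u \<in> words_of_rank n (m * m') \<rho>. stable_rank n (\<lambda>i. u i mod m') \<pi>} =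
      card (words_of_rank n m (\<rho> \<circ> inv \<pi>)) * card (words_of_rank n m' \<pi>)"
    if \<pi>: "\<pi> \<in> S n" for \<pi>
  proof -
    have p: "\<pi> permutes {1..n}" using \<pi> by (simp add: S_def)
    note q = permutes_inv[OF p]
    have in1: "\<pi> i \<in> {1..n} \<longleftrightarrow> i \<in> {1..n}" "inv \<pi> i \<in> {1..n} \<longleftrightarrow> i \<in> {1..n}" for i
      using permutes_in_image[OF p] permutes_in_image[OF q] by auto
    have inv: "inv \<pi> (\<pi> i) = i" "\<pi> (inv \<pi> i) = i" for i
      using permutes_inverses[OF p] by auto
    have \<rho>': "\<rho> = (\<rho> \<circ> inv \<pi>) \<circ> \<pi>" by (simp add: fun_eq_iff inv)
    let ?F = "\<lambda>(f, g). restrict (\<lambda>i. f (\<pi> i) * m' + g i) {1..n} :: nat \<Rightarrow> nat"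
    let ?G = "\<lambda>u. (restrict (\<lambda>i. u (inv \<pi> i) div m') {1..n}, restrict (\<lambda>i. u i mod m') {1..n})"
    let ?A = "words_of_rank n m (\<rho> \<circ> inv \<pi>) \<times> words_of_rank n m' \<pi>"
    let ?B = "{u \<in> words_of_rank n (m * m') \<rho>. stable_rank n (\<lambda>i. u i mod m') \<pi>}"
    have "bij_betw ?F ?A ?B"
    proof (rule bij_betw_byWitness[where f' = ?G])
      show "\<forall>a\<in>?A. ?G (?F a) = a"
      proof
        fix a assume "a \<in> ?A"
        then obtain f g where a: "a = (f, g)" and
          f: "f \<in> words_of_rank n m (\<rho> \<circ> inv \<pi>)" and g: "g \<in> words_of_rank n m' \<pi>" by blast
        have gm: "g i < m'" if "i \<in> {1..n}" for i
          using g that unfolding words_of_rank_def words_def by (auto simp: PiE_iff)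
        have out: "f i = undefined" "g i = undefined" if "i \<notin> {1..n}" for i
          using f g that unfolding words_of_rank_def words_def by (blast intro: PiE_arb)+
        show "?G (?F a) = a"
          unfolding a
        proof (simp only: prod.case prod.inject, intro conjI ext)
          fix i
          show "restrict (\<lambda>i. restrict (\<lambda>i. f (\<pi> i) * m' + g i) {1..n} (inv \<pi> i) div m') {1..n} i = f i"
            using out[of i] gm[of "inv \<pi> i"] in1(2)[of i] inv
            by (cases "i \<in> {1..n}") (simp_all del: atLeastAtMost_iff)
          show "restrict (\<lambda>i. restrict (\<lambda>i. f (\<pi> i) * m' + g i) {1..n} i mod m') {1..n} i = g i"
            using out[of i] gm[of i]
            by (cases "i \<in> {1..n}") (simp_all del: atLeastAtMost_iff)
        qed
      qed
      show "\<forall>u\<in>?B. ?F (?G u) = u"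
      proof
        fix u assume "u \<in> ?B"
        then have u: "u \<in> words_of_rank n (m * m') \<rho>" by blast
        have out: "u i = undefined" if "i \<notin> {1..n}" for i
          using u that unfolding words_of_rank_def words_def by (blast intro: PiE_arb)
        show "?F (?G u) = u"
        proof (rule ext)
          fix i
          show "?F (?G u) i = u i"
            using out[of i] in1(1)[of i] inv
            by (cases "i \<in> {1..n}") (simp_all del: atLeastAtMost_iff)
        qed
      qed
      show "?F ` ?A \<subseteq> ?B"
      proof (rule image_subsetI)
        fix a assume "a \<in> ?A"
        then obtain f g where a: "a = (f, g)" and
          f: "f \<in> words_of_rank n m (\<rho> \<circ> inv \<pi>)" and g: "g \<in> words_of_rank n m' \<pi>" by blast
        let ?u = "restrict (\<lambda>i. f (\<pi> i) * m' + g i) {1..n}"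
        have gm: "g i < m'" if "i \<in> {1..n}" for i
          using g that by (auto simp: words_of_rank_def words_def PiE_iff)
        have "?u i < m * m'" if "i \<in> {1..n}" for i
        proof -
          have "f (\<pi> i) < m" using f in1 that by (auto simp: words_of_rank_def words_def PiE_iff)
          then have "Suc (f (\<pi> i)) * m' \<le> m * m'" by (intro mult_le_mono1) simp
          then show ?thesis using gm[OF that] that by simp
        qed
        then have "?u \<in> words n (m * m')" by (auto simp: words_def PiE_iff)
        moreover have "stable_rank n ?u ((\<rho> \<circ> inv \<pi>) \<circ> \<pi>) \<longleftrightarrow> stable_rank n f (\<rho> \<circ> inv \<pi>)"
          using g gm mult_add_less_iff_lex
          by (intro stable_rank_lexicographic[OF \<pi>, of g]) (simp_all add: words_of_rank_def)
        moreover have "stable_rank n (\<lambda>i. ?u i mod m') \<pi>"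
          using g gm by (auto simp: words_of_rank_def stable_rank_def)
        ultimately show "?F a \<in> ?B"
          using f \<rho>' unfolding a words_of_rank_def by simp
      qed
      show "?G ` ?B \<subseteq> ?A"
      proof (rule image_subsetI)
        fix u assume "u \<in> ?B"
        then have u: "u \<in> words_of_rank n (m * m') \<rho>" and g: "stable_rank n (\<lambda>i. u i mod m') \<pi>"
          by blast+
        have um: "u i < m * m'" if "i \<in> {1..n}" for i
          using u that by (auto simp: words_of_rank_def words_def PiE_iff)
        have m': "0 < m'" if "i \<in> {1..n}" for i using um[OF that] by (cases m') auto
        let ?f = "restrict (\<lambda>i. u (inv \<pi> i) div m') {1..n}"
        have "?f \<in> words n m"
          using um in1(2) by (auto simp: words_def PiE_iff less_mult_imp_div_less)
        moreover have "restrict (\<lambda>i. u i mod m') {1..n} \<in> words n m'"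
          using m' by (auto simp: words_def PiE_iff)
        moreover have "stable_rank n (restrict (\<lambda>i. u i mod m') {1..n}) \<pi>"
          using g by (simp add: stable_rank_def)
        moreover have "stable_rank n u ((\<rho> \<circ> inv \<pi>) \<circ> \<pi>) \<longleftrightarrow> stable_rank n ?f (\<rho> \<circ> inv \<pi>)"
        proof (rule stable_rank_lexicographic[OF \<pi> g])
          fix i j assume ij: "i \<in> {1..n}" "j \<in> {1..n}"
          show "(u i < u j \<longleftrightarrow> ?f (\<pi> i) < ?f (\<pi> j) \<or> ?f (\<pi> i) = ?f (\<pi> j) \<and> u i mod m' < u j mod m') \<and>
            (u i = u j \<longleftrightarrow> ?f (\<pi> i) = ?f (\<pi> j) \<and> u i mod m' = u j mod m')"
            using mult_add_less_iff_lex[of "u i mod m'" m' "u j mod m'" "u i div m'" "u j div m'"]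
              m'[OF ij(1)] in1 ij inv by (simp del: atLeastAtMost_iff)
        qed
        ultimately show "?G u \<in> ?A" using u \<rho>' by (simp add: words_of_rank_def)
      qed
    qed
    from bij_betw_same_card[OF this] show ?thesis by (simp only: card_cartesian_product)
  qed
  have "card (words_of_rank n (m * m') \<rho>) =
      (\<Sum>\<pi>\<in>S n. card (words_of_rank n m (\<rho> \<circ> inv \<pi>)) * card (words_of_rank n m' \<pi>))"
    using card_partition_by_rank[of "words_of_rank n (m * m') \<rho>" n "\<lambda>u i. u i mod m'"] fibre by simp
  also have "\<dots> = (\<Sum>\<tau>\<in>S n. card (words_of_rank n m \<tau>) * card (words_of_rank n m' (inv \<tau> \<circ> \<rho>)))"
  proof (rule sum.reindex_bij_witness[of _ "\<lambda>\<tau>. inv \<tau> \<circ> \<rho>" "\<lambda>\<pi>. \<rho> \<circ> inv \<pi>"])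
    fix \<pi> assume "\<pi> \<in> S n"
    then have p: "\<pi> permutes {1..n}" by (simp add: S_def)
    show eq: "inv (\<rho> \<circ> inv \<pi>) \<circ> \<rho> = \<pi>"
      using o_inv_distrib[OF permutes_bij[OF r] bij_imp_bij_inv[OF permutes_bij[OF p]]]
        inv_inv_eq[OF permutes_bij[OF p]] permutes_inverses[OF r]
      by (simp add: fun_eq_iff)
    show "\<rho> \<circ> inv \<pi> \<in> S n" using permutes_compose[OF permutes_inv[OF p] r] by (simp add: S_def)
    show "card (words_of_rank n m (\<rho> \<circ> inv \<pi>)) * card (words_of_rank n m' (inv (\<rho> \<circ> inv \<pi>) \<circ> \<rho>)) =
        card (words_of_rank n m (\<rho> \<circ> inv \<pi>)) * card (words_of_rank n m' \<pi>)" by (simp only: eq)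
  next
    fix \<tau> assume "\<tau> \<in> S n"
    then have t: "\<tau> permutes {1..n}" by (simp add: S_def)
    show "inv \<tau> \<circ> \<rho> \<in> S n" using permutes_compose[OF r permutes_inv[OF t]] by (simp add: S_def)
    show "\<rho> \<circ> inv (inv \<tau> \<circ> \<rho>) = \<tau>"
      using o_inv_distrib[OF bij_imp_bij_inv[OF permutes_bij[OF t]] permutes_bij[OF r]]
        inv_inv_eq[OF permutes_bij[OF t]] permutes_inverses[OF r]
      by (simp add: fun_eq_iff)
  qed
  finally show ?thesis .
qed

section \<open>Repeated shuffles as mixtures of m-shuffles\<close>

lemma m_shuffle_eq_words:
  assumes "\<sigma> \<in> S n"
  shows "m_shuffle n m \<sigma> = real (card (words_of_rank n m \<sigma>)) / real m ^ n"
  using assms by (simp add: m_shuffle_def card_words_of_rank)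

lemma m_shuffle_nonneg: "0 \<le> m_shuffle n m \<sigma>"
  by (simp add: m_shuffle_def)

lemma m_shuffle_le_1:
  assumes "\<sigma> \<in> S n"
  shows "m_shuffle n m \<sigma> \<le> 1"
proof -
  have "card (words_of_rank n m \<sigma>) \<le> card (words n m)"
    by (intro card_mono) (auto simp: words_of_rank_def)
  then have "real (card (words_of_rank n m \<sigma>)) \<le> real m ^ n"
    by (simp flip: of_nat_power)
  then show ?thesis using assms by (cases "real m ^ n = 0") (simp_all add: m_shuffle_eq_words divide_le_eq_1)
qed

lemma sum_m_shuffle:
  assumes "m \<ge> 1"
  shows "(\<Sum>\<sigma>\<in>S n. m_shuffle n m \<sigma>) = 1"
proof -
  have "(\<Sum>\<sigma>\<in>S n. m_shuffle n m \<sigma>) = (\<Sum>\<sigma>\<in>S n. real (card (words_of_rank n m \<sigma>))) / real m ^ n"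
    by (simp add: m_shuffle_eq_words sum_divide_distrib)
  also have "(\<Sum>\<sigma>\<in>S n. real (card (words_of_rank n m \<sigma>))) = real m ^ n"
    by (simp add: sum_card_words_of_rank flip: of_nat_sum)
  finally show ?thesis using assms by simp
qed

lemma inv_comp_in_S:
  assumes "\<tau> \<in> S n" "\<rho> \<in> S n"
  shows "inv \<tau> \<circ> \<rho> \<in> S n"
  using assms permutes_compose[OF _ permutes_inv] unfolding S_def by blast

lemma m_shuffle_mult:
  assumes "\<rho> \<in> S n"
  shows "(\<Sum>\<tau>\<in>S n. m_shuffle n a \<tau> * m_shuffle n b (inv \<tau> \<circ> \<rho>)) = m_shuffle n (a * b) \<rho>"
proof -
  have "(\<Sum>\<tau>\<in>S n. m_shuffle n a \<tau> * m_shuffle n b (inv \<tau> \<circ> \<rho>)) =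
    (\<Sum>\<tau>\<in>S n. real (card (words_of_rank n a \<tau>) * card (words_of_rank n b (inv \<tau> \<circ> \<rho>))) / (real a ^ n * real b ^ n))"
    using assms by (intro sum.cong) (simp_all add: m_shuffle_eq_words inv_comp_in_S)
  also have "\<dots> = m_shuffle n (a * b) \<rho>"
    using assms
    by (simp add: m_shuffle_eq_words card_words_of_rank_mult power_mult_distrib flip: sum_divide_distrib)
  finally show ?thesis .
qed

text \<open>
  The only word over one letter is constant, and a stable sort leaves it in place.
\<close>

lemma m_shuffle_1:
  assumes "\<sigma> \<in> S n"
  shows "m_shuffle n 1 \<sigma> = (if \<sigma> = id then 1 else 0)"
proof -
  let ?w = "restrict (\<lambda>_. 0) {1..n} :: nat \<Rightarrow> nat"
  have "words n 1 = {?w}" by (auto simp: words_def PiE_iff fun_eq_iff extensional_def)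
  moreover have "id \<in> S n" "stable_rank n ?w id" by (auto simp: S_def permutes_id stable_rank_def)
  then have "stable_rank n ?w \<sigma> \<longleftrightarrow> \<sigma> = id"
    using ex1_stable_rank[of n ?w] assms by auto
  ultimately have "words_of_rank n 1 \<sigma> = (if \<sigma> = id then {?w} else {})"
    by (auto simp: words_of_rank_def)
  then show ?thesis using m_shuffle_eq_words[OF assms, of 1] by simp
qed

lemma integrable_pmf_unit:
  fixes f :: "'a \<Rightarrow> real"
  assumes "\<And>x. 0 \<le> f x" "\<And>x. f x \<le> 1"
  shows "integrable (measure_pmf p) f"
  using assms by (intro measure_pmf.integrable_const_bound[where B = 1]) auto

lemma expectation_pmf_unit:
  fixes f :: "'a \<Rightarrow> real"
  assumes "\<And>x. 0 \<le> f x" "\<And>x. f x \<le> 1"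
  shows "0 \<le> measure_pmf.expectation p f" "measure_pmf.expectation p f \<le> 1"
proof -
  show "0 \<le> measure_pmf.expectation p f" using assms by simp
  have "measure_pmf.expectation p f \<le> measure_pmf.expectation p (\<lambda>_. 1)"
    using assms by (intro integral_mono integrable_pmf_unit) auto
  then show "measure_pmf.expectation p f \<le> 1" by simp
qed

text \<open>
  For functions with values in the unit interval every expectation exists. Indicators, negative powers
  of positive integers and shuffle probabilities are all of this kind.
\<close>

lemma expectation_bind_pmf:
  fixes f :: "'b \<Rightarrow> real"
  assumes f: "\<And>x. 0 \<le> f x" "\<And>x. f x \<le> 1"
  shows "measure_pmf.expectation (bind_pmf p q) f =
    measure_pmf.expectation p (\<lambda>x. measure_pmf.expectation (q x) f)"
proof -
  note E = expectation_pmf_unit[of f, OF f]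
  have "ennreal (measure_pmf.expectation (bind_pmf p q) f) = (\<integral>\<^sup>+y. ennreal (f y) \<partial>bind_pmf p q)"
    using f by (intro nn_integral_eq_integral[symmetric] integrable_pmf_unit) auto
  also have "\<dots> = (\<integral>\<^sup>+x. \<integral>\<^sup>+y. ennreal (f y) \<partial>q x \<partial>p)" by simp
  also have "\<dots> = (\<integral>\<^sup>+x. ennreal (measure_pmf.expectation (q x) f) \<partial>p)"
    using f by (subst nn_integral_eq_integral) (auto intro: integrable_pmf_unit)
  also have "\<dots> = ennreal (measure_pmf.expectation p (\<lambda>x. measure_pmf.expectation (q x) f))"
    using E by (intro nn_integral_eq_integral integrable_pmf_unit) auto
  finally show ?thesis using E f by (simp add: Bochner_Integration.integral_nonneg)
qed

text \<open>
  The newest factor is drawn outermost, so that one can condition on it and apply an induction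
  hypothesis to the product of the others.
\<close>

primrec product_pmf :: "nat pmf \<Rightarrow> nat \<Rightarrow> nat pmf" where
  "product_pmf p 0 = return_pmf 1"
| "product_pmf p (Suc k) = bind_pmf p (\<lambda>b. map_pmf (\<lambda>a. a * b) (product_pmf p k))"

lemma expectation_product_pmf_Suc:
  fixes f :: "nat \<Rightarrow> real"
  assumes "\<And>x. 0 \<le> f x" "\<And>x. f x \<le> 1"
  shows "measure_pmf.expectation (product_pmf p (Suc k)) f =
    measure_pmf.expectation p (\<lambda>b. measure_pmf.expectation (product_pmf p k) (\<lambda>a. f (a * b)))"
  using assms by (simp add: expectation_bind_pmf)

lemma set_product_pmf:
  assumes "set_pmf p \<subseteq> {1..}"
  shows "set_pmf (product_pmf p k) \<subseteq> {1..}"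
  using assms by (induction k) fastforce+

lemma p_shuffle_eq_expectation:
  assumes p: "set_pmf p \<subseteq> {1..}" and \<sigma>: "\<sigma> \<in> S n"
  shows "p_shuffle n p \<sigma> = measure_pmf.expectation p (\<lambda>m. m_shuffle n m \<sigma>)"
proof -
  let ?f = "\<lambda>m. pmf p m * m_shuffle n m \<sigma>"
  have "Infinite_Set_Sum.abs_summable_on ?f UNIV"
  proof (rule abs_summable_on_comparison_test[of "pmf p"])
    show "norm (?f m) \<le> norm (pmf p m)" for m
      using m_shuffle_nonneg m_shuffle_le_1[OF \<sigma>] by (simp add: mult_left_le)
  qed (simp add: pmf_abs_summable)
  then have "measure_pmf.expectation p (\<lambda>m. m_shuffle n m \<sigma>) = infsum ?f UNIV"
    by (simp add: pmf_expectation_eq_infsetsum infsetsum_infsum)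
  also have "\<dots> = infsum ?f {1..}"
    using p by (intro infsum_cong_neutral) (auto simp: set_pmf_iff)
  finally show ?thesis by (simp add: p_shuffle_def)
qed

text \<open>
  By linearity, the multiplication rule for \<open>m\<close>-shuffles passes to mixtures.
\<close>

lemma conv_power_eq_expectation:
  assumes p: "set_pmf p \<subseteq> {1..}" and "\<rho> \<in> S n"
  shows "conv_power n (p_shuffle n p) k \<rho> =
    measure_pmf.expectation (product_pmf p k) (\<lambda>m. m_shuffle n m \<rho>)"
  using assms(2)
proof (induction k arbitrary: \<rho>)
  case 0
  then show ?case using m_shuffle_1 by simp
next
  case (Suc k)
  let ?Z = "product_pmf p k" and ?E = "measure_pmf.expectation"
  note unit = m_shuffle_nonneg m_shuffle_le_1
  have "conv_power n (p_shuffle n p) (Suc k) \<rho> =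
      (\<Sum>\<tau>\<in>S n. ?E ?Z (\<lambda>a. m_shuffle n a \<tau>) * ?E p (\<lambda>b. m_shuffle n b (inv \<tau> \<circ> \<rho>)))"
    using Suc p by (simp add: convolution_def inv_comp_in_S p_shuffle_eq_expectation)
  also have "\<dots> = (\<Sum>\<tau>\<in>S n. ?E p (\<lambda>b. ?E ?Z (\<lambda>a. m_shuffle n a \<tau>) * m_shuffle n b (inv \<tau> \<circ> \<rho>)))"
    by simp
  also have "\<dots> = ?E p (\<lambda>b. \<Sum>\<tau>\<in>S n. ?E ?Z (\<lambda>a. m_shuffle n a \<tau>) * m_shuffle n b (inv \<tau> \<circ> \<rho>))"
    using Suc.prems
    by (intro Bochner_Integration.integral_sum[symmetric] integrable_mult_right integrable_pmf_unit)
      (auto intro: unit inv_comp_in_S)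
  also have "\<dots> = ?E p (\<lambda>b. \<Sum>\<tau>\<in>S n. ?E ?Z (\<lambda>a. m_shuffle n a \<tau> * m_shuffle n b (inv \<tau> \<circ> \<rho>)))"
    by simp
  also have "\<dots> = ?E p (\<lambda>b. ?E ?Z (\<lambda>a. \<Sum>\<tau>\<in>S n. m_shuffle n a \<tau> * m_shuffle n b (inv \<tau> \<circ> \<rho>)))"
    using Suc.prems
    by (intro Bochner_Integration.integral_cong refl Bochner_Integration.integral_sum[symmetric]
        integrable_mult_left integrable_pmf_unit)
      (auto intro: unit inv_comp_in_S)
  also have "\<dots> = ?E p (\<lambda>b. ?E ?Z (\<lambda>a. m_shuffle n (a * b) \<rho>))"
    using Suc.prems by (simp add: m_shuffle_mult)
  also have "\<dots> = ?E (product_pmf p (Suc k)) (\<lambda>m. m_shuffle n m \<rho>)"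
    using Suc.prems by (intro expectation_product_pmf_Suc[symmetric] unit) auto
  finally show ?case .
qed

section \<open>Fluctuations of the number of rising sequences\<close>

text \<open>
  The uniform law has \<open>(n + 1) / 2\<close> rising sequences on average. Shuffles with few packs have fewer, so
  positive values speak against uniformity.
\<close>

definition centred_deficit :: "nat \<Rightarrow> (nat \<Rightarrow> nat) \<Rightarrow> real" where
  "centred_deficit n \<sigma> = (real n + 1) / 2 - real (rising_sequences n \<sigma>)"

definition order_sign :: "(nat \<Rightarrow> nat) \<Rightarrow> nat \<Rightarrow> real" where
  "order_sign \<tau> i = (if \<tau> (Suc i) < \<tau> i then - 1 else 1)"

lemma centred_deficit_eq_sum:
  assumes "n \<ge> 1"
  shows "centred_deficit n \<sigma> = (\<Sum>i\<in>{1..<n}. order_sign (inv \<sigma>) i) / 2"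
proof -
  have "(\<Sum>i\<in>{1..<n}. order_sign (inv \<sigma>) i) =
      (\<Sum>i\<in>{1..<n}. 1 - 2 * (if inv \<sigma> (i + 1) < inv \<sigma> i then 1 else 0))"
    by (intro sum.cong) (auto simp: order_sign_def)
  also have "\<dots> = real (n - 1) - 2 * (\<Sum>i\<in>{1..<n}. (if inv \<sigma> (i + 1) < inv \<sigma> i then 1 else 0))"
    by (simp add: sum_subtractf sum_distrib_left)
  also have "(\<Sum>i\<in>{1..<n}. (if inv \<sigma> (i + 1) < inv \<sigma> i then 1 else 0 :: real)) =
      real (card {i \<in> {1..<n}. inv \<sigma> (i + 1) < inv \<sigma> i})"
    by (simp flip: sum.inter_filter)
  finally show ?thesis using assms
    by (simp add: centred_deficit_def rising_sequences_def of_nat_diff field_simps)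
qed

text \<open>
  Exchanging the values at \<open>i\<close> and \<open>i + 1\<close> is an involution on permutations that flips the sign at \<open>i\<close>
  and keeps the sign at \<open>j\<close>, whose two positions are different from these.
\<close>

lemma sum_order_sign_distant:
  assumes ij: "i \<in> {1..<n}" "j \<in> {1..<n}" and far: "j \<noteq> i" "j \<noteq> Suc i" "i \<noteq> Suc j"
  shows "(\<Sum>\<tau>\<in>S n. order_sign \<tau> i * order_sign \<tau> j) = 0"
proof -
  let ?t = "Transposition.transpose i (Suc i)"
  have t: "?t permutes {1..n}" using ij by (intro permutes_swap_id) auto
  have "(\<Sum>\<tau>\<in>S n. order_sign \<tau> i * order_sign \<tau> j) = (\<Sum>\<tau>\<in>S n. - (order_sign \<tau> i * order_sign \<tau> j))"
  proof (rule sum.reindex_bij_witness[of _ "\<lambda>\<tau>. \<tau> \<circ> ?t" "\<lambda>\<tau>. \<tau> \<circ> ?t"])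
    fix \<tau> assume \<tau>: "\<tau> \<in> S n"
    then have inj: "inj \<tau>" by (simp add: S_def permutes_inj)
    show "(\<tau> \<circ> ?t) \<circ> ?t = \<tau>" "(\<tau> \<circ> ?t) \<circ> ?t = \<tau>" by (simp_all add: comp_assoc)
    show "\<tau> \<circ> ?t \<in> S n" "\<tau> \<circ> ?t \<in> S n" using permutes_compose[OF t] \<tau> by (auto simp: S_def)
    have "\<tau> (Suc i) \<noteq> \<tau> i" using inj by (simp add: inj_eq)
    then have "order_sign (\<tau> \<circ> ?t) i = - order_sign \<tau> i" by (auto simp: order_sign_def)
    moreover have "order_sign (\<tau> \<circ> ?t) j = order_sign \<tau> j"
      using far by (simp add: order_sign_def Transposition.transpose_def)
    ultimately show "- (order_sign (\<tau> \<circ> ?t) i * order_sign (\<tau> \<circ> ?t) j) = order_sign \<tau> i * order_sign \<tau> j"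
      by simp
  qed
  then show ?thesis by (simp add: sum_negf)
qed

text \<open>
  The deficit is half a sum of signs. In its square each index contributes only together with itself
  and its two neighbours.
\<close>

lemma centred_deficit_second_moment:
  assumes "n \<ge> 1"
  shows "(\<Sum>\<sigma>\<in>S n. (centred_deficit n \<sigma>)\<^sup>2) \<le> real n * fact n"
proof -
  let ?I = "{1..<n}"
  have near: "(\<Sum>\<tau>\<in>S n. order_sign \<tau> i * order_sign \<tau> j) \<le> fact n" for i j
  proof -
    have "(\<Sum>\<tau>\<in>S n. order_sign \<tau> i * order_sign \<tau> j) \<le> (\<Sum>\<tau>\<in>S n. 1)"
      by (intro sum_mono) (simp add: order_sign_def)
    then show ?thesis by simp
  qed
  have row: "(\<Sum>j\<in>?I. \<Sum>\<tau>\<in>S n. order_sign \<tau> i * order_sign \<tau> j) \<le> 3 * fact n" if i: "i \<in> ?I" for i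
  proof -
    have "(\<Sum>j\<in>?I. \<Sum>\<tau>\<in>S n. order_sign \<tau> i * order_sign \<tau> j) =
        (\<Sum>j\<in>?I \<inter> {i - 1, i, Suc i}. \<Sum>\<tau>\<in>S n. order_sign \<tau> i * order_sign \<tau> j)"
      using i by (intro sum.mono_neutral_right ballI sum_order_sign_distant) auto
    also have "\<dots> \<le> (\<Sum>j\<in>?I \<inter> {i - 1, i, Suc i}. fact n)" by (intro sum_mono near)
    also have "\<dots> = real (card (?I \<inter> {i - 1, i, Suc i})) * fact n" by simp
    also have "\<dots> \<le> real 3 * fact n"
    proof (intro mult_right_mono)
      have "card (?I \<inter> {i - 1, i, Suc i}) \<le> card {i - 1, i, Suc i}" by (intro card_mono) auto
      also have "\<dots> \<le> 3" by (simp add: card_insert_if)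
      finally show "real (card (?I \<inter> {i - 1, i, Suc i})) \<le> real 3" by simp
    qed simp
    finally show ?thesis by simp
  qed
  have "(\<Sum>\<sigma>\<in>S n. (centred_deficit n \<sigma>)\<^sup>2) = (\<Sum>\<sigma>\<in>S n. ((\<Sum>i\<in>?I. order_sign (inv \<sigma>) i) / 2)\<^sup>2)"
    using assms by (simp add: centred_deficit_eq_sum)
  also have "\<dots> = (\<Sum>\<tau>\<in>S n. ((\<Sum>i\<in>?I. order_sign \<tau> i) / 2)\<^sup>2)"
    by (rule sum.reindex_bij_witness[of _ inv inv])
      (auto simp: S_def permutes_inv permutes_inv_inv)
  also have "\<dots> = (\<Sum>i\<in>?I. \<Sum>j\<in>?I. \<Sum>\<tau>\<in>S n. order_sign \<tau> i * order_sign \<tau> j) / 4"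
    by (simp add: power2_eq_square sum_product sum.swap[of _ "S n"] flip: sum_divide_distrib)
  also have "\<dots> \<le> (\<Sum>i\<in>?I. 3 * fact n) / 4" using row by (intro divide_right_mono sum_mono) auto
  also have "\<dots> \<le> real n * fact n" by (simp add: of_nat_diff)
  finally show ?thesis .
qed

section \<open>The density of an m-shuffle with respect to the uniform law\<close>

lemma choose_mult_fact_eq_prod:
  "real ((n + a) choose n) * fact n = (\<Prod>j\<in>{1..n}. real a + real j)"
proof -
  have "pochhammer (real a + 1) n = (\<Prod>j\<in>{1..n}. real a + real j)"
    unfolding pochhammer_prod
    by (rule prod.reindex_bij_witness[of _ "\<lambda>j. j - 1" Suc]) auto
  then show ?thesis
    by (simp add: binomial_gbinomial gbinomial_pochhammer' algebra_simps)
qed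

lemma rising_sequences_bounds: "1 \<le> rising_sequences n \<sigma>" "n \<ge> 1 \<Longrightarrow> rising_sequences n \<sigma> \<le> n"
proof -
  have "card {i \<in> {1..<n}. inv \<sigma> (i + 1) < inv \<sigma> i} \<le> card {1..<n}" by (intro card_mono) auto
  then show "n \<ge> 1 \<Longrightarrow> rising_sequences n \<sigma> \<le> n" by (simp add: rising_sequences_def)
qed (simp add: rising_sequences_def)

text \<open>
  The density of an \<open>m\<close>-shuffle with respect to the uniform law is the product of \<open>1 + x\<close> over these
  quantities \<open>x\<close>.
\<close>

definition factor_excess :: "nat \<Rightarrow> nat \<Rightarrow> (nat \<Rightarrow> nat) \<Rightarrow> nat \<Rightarrow> real" where
  "factor_excess n m \<sigma> j = (real j - real (rising_sequences n \<sigma>)) / real m"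

lemma fact_mult_m_shuffle:
  assumes "1 \<le> m" "rising_sequences n \<sigma> \<le> m"
  shows "fact n * m_shuffle n m \<sigma> = (\<Prod>j\<in>{1..n}. 1 + factor_excess n m \<sigma> j)"
proof -
  let ?r = "rising_sequences n \<sigma>"
  have "fact n * m_shuffle n m \<sigma> = (\<Prod>j\<in>{1..n}. real (m - ?r) + real j) / real m ^ n"
    using assms choose_mult_fact_eq_prod[of n "m - ?r"] by (simp add: m_shuffle_def mult.commute)
  also have "\<dots> = (\<Prod>j\<in>{1..n}. (real (m - ?r) + real j) / real m)"
    by (simp add: prod_dividef)
  also have "\<dots> = (\<Prod>j\<in>{1..n}. 1 + factor_excess n m \<sigma> j)"
    using assms by (intro prod.cong) (simp_all add: factor_excess_def of_nat_diff field_simps)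
  finally show ?thesis .
qed

lemma factor_excess_gt:
  assumes "1 \<le> m" "rising_sequences n \<sigma> \<le> m" "j \<in> {1..n}"
  shows "-1 < factor_excess n m \<sigma> j"
  using assms by (simp add: factor_excess_def field_simps)

lemma abs_factor_excess_le:
  assumes "j \<in> {1..n}"
  shows "\<bar>factor_excess n m \<sigma> j\<bar> \<le> real n / real m"
proof -
  have "\<bar>real j - real (rising_sequences n \<sigma>)\<bar> \<le> real n"
    using assms rising_sequences_bounds[of n \<sigma>] by auto
  then show ?thesis by (simp add: factor_excess_def abs_divide divide_right_mono)
qed

lemma sum_factor_excess:
  "(\<Sum>j\<in>{1..n}. factor_excess n m \<sigma> j) = real n * centred_deficit n \<sigma> / real m"
proof -
  have "(\<Sum>j\<in>{1..n}. real j - r) = real n * ((real n + 1) / 2 - r)" for r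
    by (induction n) (auto simp: field_simps)
  then show ?thesis
    by (simp add: factor_excess_def centred_deficit_def flip: sum_divide_distrib)
qed

text \<open>
  Centring at \<open>(n + 1) / 2\<close> minimises the sum of the squares \<open>(j - r)\<^sup>2\<close>, and the minimum is
  \<open>n * (n\<^sup>2 - 1) / 12\<close>, which is at least \<open>n\<^sup>3 / 24\<close>.
\<close>

lemma sum_factor_excess_squares_ge:
  assumes "2 \<le> n"
  shows "(\<Sum>j\<in>{1..n}. (factor_excess n m \<sigma> j)\<^sup>2) \<ge> real n ^ 3 / (24 * (real m)\<^sup>2)"
proof -
  have sq: "(\<Sum>j\<in>{1..n}. (real j - r)\<^sup>2) = real n * ((real n)\<^sup>2 - 1) / 12 + real n * ((real n + 1) / 2 - r)\<^sup>2" for r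
    by (induction n) (auto simp: field_simps power2_eq_square)
  have "(real n)\<^sup>2 - 1 \<ge> (real n)\<^sup>2 / 2"
    using power_mono[of 2 "real n" 2] assms by simp
  then have "real n * ((real n)\<^sup>2 / 2) / 12 \<le> real n * ((real n)\<^sup>2 - 1) / 12"
    by (intro divide_right_mono mult_left_mono) auto
  then have "real n ^ 3 / 24 \<le> (\<Sum>j\<in>{1..n}. (real j - real (rising_sequences n \<sigma>))\<^sup>2)"
    unfolding sq by (simp add: power2_eq_square power3_eq_cube add_increasing2)
  then have "real n ^ 3 / 24 / (real m)\<^sup>2 \<le> (\<Sum>j\<in>{1..n}. (real j - real (rising_sequences n \<sigma>))\<^sup>2) / (real m)\<^sup>2"
    by (intro divide_right_mono) auto
  then show ?thesis by (simp add: factor_excess_def power_divide sum_divide_distrib)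
qed

text \<open>
  Each factor is at least \<open>exp (x - 2 * x\<^sup>2)\<close> because \<open>x\<close> is at most \<open>1 / 2\<close> in absolute value.
\<close>

lemma m_shuffle_ge:
  assumes n: "1 \<le> n" and m: "2 * n \<le> m"
  shows "fact n * m_shuffle n m \<sigma> \<ge>
    1 + real n * centred_deficit n \<sigma> / real m - 2 * real n ^ 3 / (real m)\<^sup>2"
proof -
  let ?x = "factor_excess n m \<sigma>"
  have r: "1 \<le> m" "rising_sequences n \<sigma> \<le> m" using rising_sequences_bounds[of n \<sigma>] assms by auto
  have pos: "0 < 1 + ?x j" if "j \<in> {1..n}" for j using factor_excess_gt[OF r that] by simp
  have log_ge: "?x j - 2 * (real n / real m)\<^sup>2 \<le> ln (1 + ?x j)" if j: "j \<in> {1..n}" for j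
  proof -
    have "real n / real m \<le> 1 / 2" using assms by (simp add: field_simps)
    then have "\<bar>ln (1 + ?x j) - ?x j\<bar> \<le> 2 * (?x j)\<^sup>2"
      using abs_factor_excess_le[OF j, of m \<sigma>] by (intro abs_ln_one_plus_x_minus_x_bound) linarith
    moreover have "(?x j)\<^sup>2 \<le> (real n / real m)\<^sup>2"
      using abs_factor_excess_le[OF j, of m \<sigma>] by (simp add: abs_le_square_iff[symmetric])
    ultimately show ?thesis by simp
  qed
  have "1 + real n * centred_deficit n \<sigma> / real m - 2 * real n ^ 3 / (real m)\<^sup>2 =
      1 + (\<Sum>j\<in>{1..n}. ?x j - 2 * (real n / real m)\<^sup>2)"
      proof -
    have "real n * (2 * (real n / real m)\<^sup>2) = 2 * real n ^ 3 / (real m)\<^sup>2"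
      by (simp add: power_divide power2_eq_square power3_eq_cube)
    moreover have "(\<Sum>j\<in>{1..n}. ?x j - 2 * (real n / real m)\<^sup>2) =
        (\<Sum>j\<in>{1..n}. ?x j) - real n * (2 * (real n / real m)\<^sup>2)"
      by (simp add: sum_subtractf)
    ultimately show ?thesis using sum_factor_excess[of n m \<sigma>] by linarith
  qed
  also have "\<dots> \<le> 1 + (\<Sum>j\<in>{1..n}. ln (1 + ?x j))" using log_ge by (intro add_left_mono sum_mono)
  also have "\<dots> \<le> exp (\<Sum>j\<in>{1..n}. ln (1 + ?x j))" by (rule exp_ge_add_one_self)
  also have "\<dots> = (\<Prod>j\<in>{1..n}. 1 + ?x j)" using pos by (simp add: exp_sum)
  also have "\<dots> = fact n * m_shuffle n m \<sigma>" using fact_mult_m_shuffle[OF r] by simp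
  finally show ?thesis .
qed

text \<open>
  The quadratic gain is damped by \<open>1 + \<bar>x\<bar>\<close> so that the bound holds for all \<open>x\<close>: an \<open>m\<close>-shuffle with
  \<open>m < n\<close> has factors far from \<open>1\<close>.
\<close>

lemma ln_one_plus_le_minus_square:
  fixes x :: real
  assumes "-1 < x"
  shows "ln (1 + x) \<le> x - x\<^sup>2 / (2 * (1 + \<bar>x\<bar>))"
proof (cases "0 \<le> x")
  case True
  \<comment> \<open>Twice the difference of the two sides, after a partial fraction expansion; its derivative is a square.\<close>
  let ?f = "\<lambda>x :: real. (1 + x) - inverse (1 + x) - 2 * ln (1 + x)"
  have "?f 0 \<le> ?f x"
  proof (rule DERIV_nonneg_imp_nondecreasing[OF True])
    fix y :: real assume y: "0 \<le> y" "y \<le> x"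
    have "(1 - z)\<^sup>2 = 1 + z * z - 2 * z" for z :: real
      by (simp add: power2_eq_square algebra_simps)
    moreover have "(?f has_real_derivative 1 + inverse (1 + y) * inverse (1 + y) - 2 * inverse (1 + y)) (at y)"
      using y by (auto intro!: derivative_eq_intros simp: inverse_eq_divide)
    ultimately have "(?f has_real_derivative (1 - inverse (1 + y))\<^sup>2) (at y)" by simp
    then show "\<exists>d. (?f has_real_derivative d) (at y) \<and> 0 \<le> d"
      by (intro exI[of _ "(1 - inverse (1 + y))\<^sup>2"]) simp
  qed
  then have "ln (1 + x) \<le> ((1 + x) - inverse (1 + x)) / 2" by simp
  also have "\<dots> = x - x\<^sup>2 / (2 * (1 + \<bar>x\<bar>))"
    using True by (simp add: field_simps power2_eq_square)
  finally show ?thesis .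
next
  case False
  let ?g = "\<lambda>x :: real. x - x\<^sup>2 / 2 - ln (1 + x)"
  have "?g x \<ge> ?g 0"
  proof (rule DERIV_nonpos_imp_nonincreasing[where f = ?g and a = x and b = 0])
    show "x \<le> 0" using False by simp
    fix y :: real assume y: "x \<le> y" "y \<le> 0"
    have "(?g has_real_derivative - (y\<^sup>2) / (1 + y)) (at y)"
      using y assms by (auto intro!: derivative_eq_intros simp: field_simps power2_eq_square)
    then show "\<exists>d. (?g has_real_derivative d) (at y) \<and> d \<le> 0"
      using y assms by (intro exI[of _ "- (y\<^sup>2) / (1 + y)"]) (simp add: divide_nonpos_pos)
  qed
  then have "ln (1 + x) \<le> x - x\<^sup>2 / 2" by simp
  also have "x\<^sup>2 / (2 * (1 + \<bar>x\<bar>)) \<le> x\<^sup>2 / 2" by (intro divide_left_mono) auto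
  then have "x - x\<^sup>2 / 2 \<le> x - x\<^sup>2 / (2 * (1 + \<bar>x\<bar>))" by simp
  finally show ?thesis .
qed

text \<open>
  The factors are positive unless \<open>m\<close> is smaller than the number of rising sequences, and then the
  \<open>m\<close>-shuffle has mass \<open>0\<close>. The damping \<open>1 + n / m\<close> of the quadratic term turns \<open>m\<^sup>2\<close> into
  \<open>m * (m + n)\<close>.
\<close>

lemma m_shuffle_le_exp:
  assumes n: "2 \<le> n" and m: "1 \<le> m"
  shows "fact n * m_shuffle n m \<sigma> \<le>
    exp (real n * centred_deficit n \<sigma> / real m - real n ^ 3 / (48 * real m * (real m + real n)))"
proof (cases "rising_sequences n \<sigma> \<le> m")
  case False
  have "n + m - rising_sequences n \<sigma> < n" using False n by linarith
  then show ?thesis by (simp add: m_shuffle_def binomial_eq_0)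
next
  case True
  let ?x = "factor_excess n m \<sigma>"
  let ?c = "2 * (1 + real n / real m)"
  have pos: "0 < 1 + ?x j" if "j \<in> {1..n}" for j using factor_excess_gt[OF m True that] by simp
  have log_le: "ln (1 + ?x j) \<le> ?x j - (?x j)\<^sup>2 / ?c" if j: "j \<in> {1..n}" for j
  proof -
    have "ln (1 + ?x j) \<le> ?x j - (?x j)\<^sup>2 / (2 * (1 + \<bar>?x j\<bar>))"
      using pos[OF j] by (intro ln_one_plus_le_minus_square) simp
    also have "(?x j)\<^sup>2 / ?c \<le> (?x j)\<^sup>2 / (2 * (1 + \<bar>?x j\<bar>))"
      using abs_factor_excess_le[OF j, of m \<sigma>] by (intro divide_left_mono) (auto intro!: mult_pos_pos add_pos_nonneg)
    then have "?x j - (?x j)\<^sup>2 / (2 * (1 + \<bar>?x j\<bar>)) \<le> ?x j - (?x j)\<^sup>2 / ?c" by simp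
    finally show ?thesis .
  qed
  have "fact n * m_shuffle n m \<sigma> = (\<Prod>j\<in>{1..n}. 1 + ?x j)" by (rule fact_mult_m_shuffle[OF m True])
  also have "\<dots> = exp (\<Sum>j\<in>{1..n}. ln (1 + ?x j))" using pos by (simp add: exp_sum)
  also have "\<dots> \<le> exp (\<Sum>j\<in>{1..n}. ?x j - (?x j)\<^sup>2 / ?c)" by (subst exp_le_cancel_iff) (intro sum_mono log_le)
  also have "(\<Sum>j\<in>{1..n}. ?x j - (?x j)\<^sup>2 / ?c) =
      real n * centred_deficit n \<sigma> / real m - (\<Sum>j\<in>{1..n}. (?x j)\<^sup>2) / ?c"
    by (simp only: sum_subtractf sum_factor_excess sum_divide_distrib)
  also have "exp \<dots> \<le> exp (real n * centred_deficit n \<sigma> / real m - real n ^ 3 / (24 * (real m)\<^sup>2) / ?c)"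
    using sum_factor_excess_squares_ge[OF n, of m \<sigma>]
    by (subst exp_le_cancel_iff) (intro diff_left_mono divide_right_mono, auto)
  also have "real n ^ 3 / (24 * (real m)\<^sup>2) / ?c = real n ^ 3 / (48 * real m * (real m + real n))"
    using m by (simp add: field_simps power2_eq_square)
  finally show ?thesis .
qed

lemma sum_abs_centred_deficit:
  assumes "n \<ge> 1"
  shows "(\<Sum>\<sigma>\<in>S n. \<bar>centred_deficit n \<sigma>\<bar>) \<le> sqrt (real n) * fact n"
proof -
  let ?q = "sqrt (real n)"
  have q: "?q > 0" "?q * ?q = real n" using assms by auto
  \<comment> \<open>The inequality of the arithmetic and geometric means, at the scale \<open>sqrt n\<close> of \<open>h\<close>.\<close>
  have "\<bar>h\<bar> \<le> (h\<^sup>2 / ?q + ?q) / 2" for h :: real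
  proof -
    have "0 \<le> (\<bar>h\<bar> - ?q)\<^sup>2" by simp
    then have "2 * \<bar>h\<bar> * ?q \<le> h\<^sup>2 + ?q * ?q" by (simp add: power2_diff power2_eq_square algebra_simps)
    then show ?thesis using q(1) by (simp add: field_simps)
  qed
  then have "(\<Sum>\<sigma>\<in>S n. \<bar>centred_deficit n \<sigma>\<bar>) \<le> (\<Sum>\<sigma>\<in>S n. ((centred_deficit n \<sigma>)\<^sup>2 / ?q + ?q) / 2)"
    by (intro sum_mono)
  also have "\<dots> = ((\<Sum>\<sigma>\<in>S n. (centred_deficit n \<sigma>)\<^sup>2) / ?q + ?q * fact n) / 2"
    by (simp add: sum.distrib mult.commute flip: sum_divide_distrib)
  also have "\<dots> \<le> (real n * fact n / ?q + ?q * fact n) / 2"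
    using centred_deficit_second_moment[OF assms] q(1) by (simp add: divide_right_mono)
  also have "\<dots> = ?q * fact n"
  proof -
    have "real n * fact n / ?q = ?q * fact n" using q by (simp add: divide_eq_eq ac_simps)
    then show ?thesis by simp
  qed
  finally show ?thesis .
qed

text \<open>
  Both laws have total mass \<open>1\<close>, so the excess on \<open>A\<close> is the shortfall on the complement, and there
  the lower bound on the density applies. It suffices to know the mean of \<open>\<bar>h\<bar>\<close>.
\<close>

lemma m_shuffle_excess_le:
  assumes n: "1 \<le> n" and m: "2 * n \<le> m" and A: "A \<subseteq> S n"
  shows "(\<Sum>\<sigma>\<in>A. m_shuffle n m \<sigma>) - (\<Sum>\<sigma>\<in>A. uniform_mass n \<sigma>) \<le>
    real n * sqrt (real n) / real m + 2 * real n ^ 3 / (real m)\<^sup>2"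
proof -
  let ?d = "\<lambda>\<sigma>. m_shuffle n m \<sigma> - uniform_mass n \<sigma>"
  let ?b = "\<lambda>\<sigma>. (real n * \<bar>centred_deficit n \<sigma>\<bar> / real m + 2 * real n ^ 3 / (real m)\<^sup>2) / fact n"
  have "(\<Sum>\<sigma>\<in>S n. ?d \<sigma>) = 0"
    using n m by (simp add: sum_subtractf sum_m_shuffle uniform_mass_def)
  then have "(\<Sum>\<sigma>\<in>A. ?d \<sigma>) = (\<Sum>\<sigma>\<in>S n - A. - ?d \<sigma>)"
    using sum.subset_diff[OF A finite_S, of ?d] by (simp only: sum_negf)
  also have "\<dots> \<le> (\<Sum>\<sigma>\<in>S n - A. ?b \<sigma>)"
  proof (intro sum_mono)
    fix \<sigma>
    have "real n * - \<bar>centred_deficit n \<sigma>\<bar> / real m \<le> real n * centred_deficit n \<sigma> / real m"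
      by (intro divide_right_mono mult_left_mono) auto
    then have "1 - (real n * \<bar>centred_deficit n \<sigma>\<bar> / real m + 2 * real n ^ 3 / (real m)\<^sup>2) \<le> fact n * m_shuffle n m \<sigma>"
      using m_shuffle_ge[OF n m, of \<sigma>] by simp
    then have "(1 - fact n * m_shuffle n m \<sigma>) / fact n \<le> ?b \<sigma>"
      by (intro divide_right_mono) auto
    then show "- ?d \<sigma> \<le> ?b \<sigma>" by (simp add: uniform_mass_def diff_divide_distrib)
  qed
  also have "\<dots> \<le> (\<Sum>\<sigma>\<in>S n. ?b \<sigma>)" by (intro sum_mono2) auto
  also have "\<dots> = (real n * (\<Sum>\<sigma>\<in>S n. \<bar>centred_deficit n \<sigma>\<bar>) / real m + fact n * (2 * real n ^ 3 / (real m)\<^sup>2)) / fact n"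
    by (simp add: sum.distrib sum_distrib_left flip: sum_divide_distrib)
  also have "\<dots> \<le> (real n * (sqrt (real n) * fact n) / real m + fact n * (2 * real n ^ 3 / (real m)\<^sup>2)) / fact n"
    using sum_abs_centred_deficit[OF n]
    by (intro divide_right_mono add_mono mult_left_mono) auto
  also have "\<dots> = real n * sqrt (real n) / real m + 2 * real n ^ 3 / (real m)\<^sup>2"
    by (simp add: field_simps)
  finally show ?thesis by (simp add: sum_subtractf)
qed

text \<open>
  The constant makes the linear term \<open>n * h / m\<close> at most half the quadratic term in
  \<open>m_shuffle_le_exp\<close>, for every \<open>m \<le> M\<close>.
\<close>

definition deficit_threshold :: "nat \<Rightarrow> real \<Rightarrow> real" where
  "deficit_threshold n M = (real n)\<^sup>2 / (96 * (M + real n))"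

text \<open>
  Below the threshold the density is uniformly tiny, so no information on the law of the deficit under
  the shuffle is needed.
\<close>

lemma m_shuffle_small_deficit:
  assumes n: "2 \<le> n" and m: "1 \<le> m" "real m \<le> M"
  shows "(\<Sum>\<sigma>\<in>{\<sigma> \<in> S n. centred_deficit n \<sigma> \<le> deficit_threshold n M}. m_shuffle n m \<sigma>) \<le>
    exp (- (real n ^ 3 / (96 * M * (M + real n))))"
proof -
  let ?B = "{\<sigma> \<in> S n. centred_deficit n \<sigma> \<le> deficit_threshold n M}"
  let ?e = "exp (- (real n ^ 3 / (96 * M * (M + real n))))"
  have scale: "h - a / (48 * b) \<le> - (a / (96 * b))" if "h \<le> a / (96 * b)" for a b h :: real
    using that by simp
  have each: "m_shuffle n m \<sigma> \<le> ?e / fact n" if "\<sigma> \<in> ?B" for \<sigma>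
  proof -
    have "centred_deficit n \<sigma> \<le> deficit_threshold n M" using that by simp
    also have "\<dots> \<le> (real n)\<^sup>2 / (96 * (real m + real n))"
      unfolding deficit_threshold_def using n m by (intro divide_left_mono) auto
    finally have "real n * centred_deficit n \<sigma> / real m \<le> real n * ((real n)\<^sup>2 / (96 * (real m + real n))) / real m"
      by (intro divide_right_mono mult_left_mono) auto
    also have "\<dots> = real n ^ 3 / (96 * real m * (real m + real n))"
      by (simp add: power2_eq_square power3_eq_cube mult_ac)
    finally have "real n * centred_deficit n \<sigma> / real m - real n ^ 3 / (48 * real m * (real m + real n))
        \<le> - (real n ^ 3 / (96 * real m * (real m + real n)))"
      by (simp only: mult.assoc scale)
    also have "\<dots> \<le> - (real n ^ 3 / (96 * M * (M + real n)))"
    proof -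
      have "96 * real m * (real m + real n) \<le> 96 * M * (M + real n)"
        using m by (intro mult_mono) auto
      then have "real n ^ 3 / (96 * M * (M + real n)) \<le> real n ^ 3 / (96 * real m * (real m + real n))"
        using m n by (intro divide_left_mono mult_pos_pos) auto
      then show ?thesis by simp
    qed
    finally have "exp (real n * centred_deficit n \<sigma> / real m - real n ^ 3 / (48 * real m * (real m + real n))) \<le> ?e"
      by simp
    then have "fact n * m_shuffle n m \<sigma> \<le> ?e"
      using m_shuffle_le_exp[OF n m(1), of \<sigma>] by linarith
    then show ?thesis by (simp add: field_simps)
  qed
  have "(\<Sum>\<sigma>\<in>?B. m_shuffle n m \<sigma>) \<le> (\<Sum>\<sigma>\<in>?B. ?e / fact n)" using each by (rule sum_mono)
  also have "\<dots> \<le> (\<Sum>\<sigma>\<in>S n. ?e / fact n)" by (intro sum_mono2) auto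
  also have "\<dots> = ?e" by simp
  finally show ?thesis .
qed

lemma uniform_large_deficit:
  assumes n: "2 \<le> n" and M: "0 < M"
  shows "(\<Sum>\<sigma>\<in>{\<sigma> \<in> S n. centred_deficit n \<sigma> > deficit_threshold n M}. uniform_mass n \<sigma>) \<le>
    real n / (deficit_threshold n M)\<^sup>2"
proof -
  let ?A = "{\<sigma> \<in> S n. centred_deficit n \<sigma> > deficit_threshold n M}"
  let ?s = "deficit_threshold n M"
  have s: "?s > 0" using n M by (simp add: deficit_threshold_def)
  have "(\<Sum>\<sigma>\<in>?A. uniform_mass n \<sigma>) \<le> (\<Sum>\<sigma>\<in>?A. (centred_deficit n \<sigma>)\<^sup>2 / ?s\<^sup>2 / fact n)"
  proof (intro sum_mono)
    fix \<sigma> assume "\<sigma> \<in> ?A"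
    then have "?s\<^sup>2 \<le> (centred_deficit n \<sigma>)\<^sup>2" using s by (intro power_mono) auto
    then have "1 \<le> (centred_deficit n \<sigma>)\<^sup>2 / ?s\<^sup>2" using s by simp
    then show "uniform_mass n \<sigma> \<le> (centred_deficit n \<sigma>)\<^sup>2 / ?s\<^sup>2 / fact n"
      unfolding uniform_mass_def card_S of_nat_fact by (rule divide_right_mono) simp
  qed
  also have "\<dots> \<le> (\<Sum>\<sigma>\<in>S n. (centred_deficit n \<sigma>)\<^sup>2 / ?s\<^sup>2 / fact n)"
    by (intro sum_mono2) auto
  also have "\<dots> = (\<Sum>\<sigma>\<in>S n. (centred_deficit n \<sigma>)\<^sup>2) / ?s\<^sup>2 / fact n"
    by (simp add: sum_divide_distrib)
  also have "\<dots> \<le> real n * fact n / ?s\<^sup>2 / fact n"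
    using centred_deficit_second_moment[of n] n by (intro divide_right_mono) auto
  finally show ?thesis by simp
qed

section \<open>Tails of a product of independent draws\<close>

lemma expectation_product_pmf_powr:
  assumes "0 \<le> \<theta>"
  shows "measure_pmf.expectation (product_pmf p k) (\<lambda>m. real m powr - \<theta>) =
    measure_pmf.expectation p (\<lambda>m. real m powr - \<theta>) ^ k"
proof (induction k)
  case (Suc k)
  have le1: "real m powr - \<theta> \<le> 1" for m
  proof (cases "m = 0")
    case False
    then have "real m powr - \<theta> \<le> real m powr 0" using assms by (intro powr_mono) auto
    then show ?thesis using False by simp
  qed simp
  have "measure_pmf.expectation (product_pmf p (Suc k)) (\<lambda>m. real m powr - \<theta>) =
      measure_pmf.expectation p (\<lambda>b. measure_pmf.expectation (product_pmf p k) (\<lambda>a. real (a * b) powr - \<theta>))"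
    by (rule expectation_product_pmf_Suc) (simp_all add: le1)
  then show ?case using Suc by (simp add: powr_mult)
qed simp

lemma pmf_prob_eq_expectation:
  "measure_pmf.prob p A = measure_pmf.expectation p (indicat_real A)"
  by simp

lemma exp_minus_le_quadratic:
  fixes u :: real
  assumes "0 \<le> u"
  shows "exp (- u) \<le> 1 - u + u\<^sup>2"
proof -
  have "1 \<le> (1 + u) * (1 - u + u\<^sup>2)" using assms by (simp add: power2_eq_square algebra_simps)
  moreover have "0 \<le> 1 - u + u\<^sup>2"
  proof -
    have "0 \<le> (u - 1 / 2)\<^sup>2" by simp
    then show ?thesis by (simp add: power2_eq_square algebra_simps)
  qed
  ultimately have "1 \<le> exp u * (1 - u + u\<^sup>2)"
    using mult_right_mono[OF exp_ge_add_one_self[of u], of "1 - u + u\<^sup>2"] by linarith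
  then show ?thesis by (simp add: exp_minus field_simps)
qed

text \<open>
  Markov's inequality for \<open>Z\<close> to the power \<open>- \<theta>\<close>. Draws beyond the cut-off \<open>L\<close> only help: for them
  the factor is bounded by \<open>1\<close>.
\<close>

lemma product_pmf_left_tail:
  assumes p: "set_pmf p \<subseteq> {1..}" and int: "integrable p (\<lambda>m. ln (real m))"
    and \<theta>: "0 \<le> \<theta>" and L: "0 \<le> L"
  shows "measure_pmf.prob (product_pmf p k) {m. ln (real m) \<le> x} \<le>
    exp (\<theta> * x - real k * \<theta> * (1 - \<theta> * L) *
      measure_pmf.expectation p (\<lambda>m. ln (real m) * indicat_real {m. ln (real m) \<le> L} m))"
proof -
  let ?g = "\<lambda>m. real m powr - \<theta>"
  let ?Y = "\<lambda>m. ln (real m) * indicat_real {m. ln (real m) \<le> L} m"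
  let ?\<nu> = "measure_pmf.expectation p ?Y"
  have intY: "integrable p ?Y" using int by (intro integrable_real_mult_indicator) auto
  have g: "?g m \<le> 1 - \<theta> * (1 - \<theta> * L) * ?Y m" if "m \<in> set_pmf p" for m
  proof -
    have m: "1 \<le> m" using that p by auto
    define y where "y = ln (real m)"
    have y: "0 \<le> y" using m by (simp add: y_def)
    have g: "?g m = exp (- (\<theta> * y))" using m by (simp add: powr_def y_def)
    show ?thesis
    proof (cases "y \<le> L")
      case True
      have "exp (- (\<theta> * y)) \<le> 1 - \<theta> * y + (\<theta> * y)\<^sup>2"
        using \<theta> y by (intro exp_minus_le_quadratic) simp
      also have "(\<theta> * y)\<^sup>2 \<le> \<theta>\<^sup>2 * L * y"
        using mult_left_mono[OF mult_right_mono[OF True y], of "\<theta>\<^sup>2"]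
        by (simp add: power2_eq_square mult_ac)
      finally show ?thesis using True g by (simp add: y_def power2_eq_square algebra_simps)
    next
      case False
      then show ?thesis using g \<theta> y by (simp add: y_def)
    qed
  qed
  have int_g: "integrable (measure_pmf q) ?g" if "set_pmf q \<subseteq> {1..}" for q
  proof (rule measure_pmf.integrable_const_bound[where B = 1])
    show "AE m in q. norm (?g m) \<le> 1"
      using that \<theta> by (auto simp: AE_measure_pmf_iff powr_def)
  qed simp
  have "measure_pmf.expectation p ?g \<le> measure_pmf.expectation p (\<lambda>m. 1 - \<theta> * (1 - \<theta> * L) * ?Y m)"
    using intY g p by (intro integral_mono_AE int_g) (auto simp: AE_measure_pmf_iff)
  also have "\<dots> = 1 - \<theta> * (1 - \<theta> * L) * ?\<nu>"
    using intY by (subst Bochner_Integration.integral_diff) auto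
  also have "\<dots> \<le> exp (- (\<theta> * (1 - \<theta> * L) * ?\<nu>))"
    using exp_ge_add_one_self[of "- (\<theta> * (1 - \<theta> * L) * ?\<nu>)"] by simp
  finally have "measure_pmf.expectation p ?g ^ k \<le> exp (- (\<theta> * (1 - \<theta> * L) * ?\<nu>)) ^ k"
    by (intro power_mono) auto
  then have pow: "measure_pmf.expectation p ?g ^ k \<le> exp (- (real k * (\<theta> * (1 - \<theta> * L) * ?\<nu>)))"
    by (simp add: exp_of_nat_mult[symmetric])
  have Z: "set_pmf (product_pmf p k) \<subseteq> {1..}" by (rule set_product_pmf[OF p])
  have "measure_pmf.prob (product_pmf p k) {m. ln (real m) \<le> x} \<le>
      measure_pmf.expectation (product_pmf p k) (\<lambda>m. exp (\<theta> * x) * ?g m)"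
    unfolding pmf_prob_eq_expectation
  proof (intro integral_mono_AE integrable_mult_right int_g Z)
    show "AE m in product_pmf p k. indicat_real {m. ln (real m) \<le> x} m \<le> exp (\<theta> * x) * ?g m"
    proof (rule AE_pmfI)
      fix m assume "m \<in> set_pmf (product_pmf p k)"
      then have "1 \<le> m" using Z by auto
      then have "exp (\<theta> * x) * ?g m = exp (\<theta> * (x - ln (real m)))"
        by (simp add: powr_def exp_add[symmetric] algebra_simps)
      then show "indicat_real {m. ln (real m) \<le> x} m \<le> exp (\<theta> * x) * ?g m"
        using \<theta> by (auto simp: indicator_def)
    qed
  qed (auto intro: integrable_pmf_unit)
  also have "\<dots> = exp (\<theta> * x) * measure_pmf.expectation p ?g ^ k"
    using expectation_product_pmf_powr[OF \<theta>] by simp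
  also have "\<dots> \<le> exp (\<theta> * x) * exp (- (real k * (\<theta> * (1 - \<theta> * L) * ?\<nu>)))"
    using pow by (intro mult_left_mono) auto
  also have "\<dots> = exp (\<theta> * x - real k * \<theta> * (1 - \<theta> * L) * ?\<nu>)"
    by (simp add: exp_add[symmetric] algebra_simps)
  finally show ?thesis .
qed

text \<open>
  Positive powers of the draws may have infinite mean, so the event that some draw exceeds the cut-off
  is paid for separately. Conditioning on one draw shifts the level \<open>x\<close> by its logarithm.
\<close>

lemma product_pmf_right_tail_aux:
  assumes p: "set_pmf p \<subseteq> {1..}" and \<theta>: "0 \<le> \<theta>"
  shows "measure_pmf.prob (product_pmf p k) {m. ln (real m) > x} \<le>
    real k * measure_pmf.prob p {m. ln (real m) > L} +
    exp (- \<theta> * x) * measure_pmf.expectation p (\<lambda>m. exp (\<theta> * ln (real m)) * indicat_real {m. ln (real m) \<le> L} m) ^ k"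
proof (induction k arbitrary: x)
  case 0
  have "indicat_real {m. ln (real m) > x} (1 :: nat) \<le> exp (- \<theta> * x)"
    using \<theta> by (auto simp: indicator_def mult_nonneg_nonpos)
  then show ?case by (simp add: measure_return_pmf)
next
  case (Suc k)
  let ?E = "measure_pmf.expectation p"
  let ?P = "measure_pmf.prob p {m. ln (real m) > L}"
  let ?h = "\<lambda>m. exp (\<theta> * ln (real m)) * indicat_real {m. ln (real m) \<le> L} m"
  let ?Z = "product_pmf p k"
  have Z: "set_pmf ?Z \<subseteq> {1..}" by (rule set_product_pmf[OF p])
  have h: "0 \<le> ?h m" "?h m \<le> exp (\<theta> * L)" for m
    using \<theta> by (auto simp: indicator_def mult_left_mono)
  have int_h: "integrable p ?h"
    using h by (intro measure_pmf.integrable_const_bound[where B = "exp (\<theta> * L)"]) auto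
  have G: "0 \<le> ?E ?h" using h by simp
  have "measure_pmf.prob (product_pmf p (Suc k)) {m. ln (real m) > x} =
      ?E (\<lambda>b. measure_pmf.expectation ?Z (\<lambda>a. indicat_real {m. ln (real m) > x} (a * b)))"
    unfolding pmf_prob_eq_expectation by (rule expectation_product_pmf_Suc) auto
  also have "\<dots> \<le> ?E (\<lambda>b. indicat_real {m. ln (real m) > L} b +
      (real k * ?P + exp (- \<theta> * x) * ?E ?h ^ k * ?h b))"
  proof (rule integral_mono_AE)
    show "integrable p (\<lambda>b. measure_pmf.expectation ?Z (\<lambda>a. indicat_real {m. ln (real m) > x} (a * b)))"
      by (intro integrable_pmf_unit expectation_pmf_unit) auto
    show "integrable p (\<lambda>b. indicat_real {m. ln (real m) > L} b +
        (real k * ?P + exp (- \<theta> * x) * ?E ?h ^ k * ?h b))"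
      using int_h by (intro Bochner_Integration.integrable_add integrable_mult_right) (auto intro: integrable_pmf_unit)
    show "AE b in p. measure_pmf.expectation ?Z (\<lambda>a. indicat_real {m. ln (real m) > x} (a * b)) \<le>
        indicat_real {m. ln (real m) > L} b + (real k * ?P + exp (- \<theta> * x) * ?E ?h ^ k * ?h b)"
    proof (rule AE_pmfI)
      fix b assume "b \<in> set_pmf p"
      then have b: "1 \<le> b" using p by auto
      show "measure_pmf.expectation ?Z (\<lambda>a. indicat_real {m. ln (real m) > x} (a * b)) \<le>
        indicat_real {m. ln (real m) > L} b + (real k * ?P + exp (- \<theta> * x) * ?E ?h ^ k * ?h b)"
      proof (cases "ln (real b) \<le> L")
        case False
        have "measure_pmf.expectation ?Z (\<lambda>a. indicat_real {m. ln (real m) > x} (a * b)) \<le> 1"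
          by (intro expectation_pmf_unit) auto
        moreover have "0 \<le> real k * ?P + exp (- \<theta> * x) * ?E ?h ^ k * ?h b"
          using G h by (intro add_nonneg_nonneg mult_nonneg_nonneg zero_le_power) auto
        moreover have "indicat_real {m. ln (real m) > L} b = 1" using False by simp
        ultimately show ?thesis by linarith
      next
        case True
        have "measure_pmf.expectation ?Z (\<lambda>a. indicat_real {m. ln (real m) > x} (a * b)) =
            measure_pmf.expectation ?Z (indicat_real {m. ln (real m) > x - ln (real b)})"
        proof (rule integral_cong_AE)
          show "AE a in ?Z. indicat_real {m. ln (real m) > x} (a * b) = indicat_real {m. ln (real m) > x - ln (real b)} a"
            using Z b by (intro AE_pmfI) (force simp: indicator_def ln_mult)
        qed auto
        also have "\<dots> \<le> real k * ?P + exp (- \<theta> * (x - ln (real b))) * ?E ?h ^ k"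
          using Suc.IH[of "x - ln (real b)"] by simp
        also have "exp (- \<theta> * (x - ln (real b))) = exp (- \<theta> * x) * exp (\<theta> * ln (real b))"
          by (simp add: exp_add[symmetric] algebra_simps)
        finally show ?thesis using True by (simp add: mult_ac)
      qed
    qed
  qed
  also have "\<dots> = ?P + (real k * ?P + exp (- \<theta> * x) * ?E ?h ^ k * ?E ?h)"
    using int_h by (subst Bochner_Integration.integral_add; simp add: integrable_pmf_unit)+
  also have "\<dots> = real (Suc k) * ?P + exp (- \<theta> * x) * ?E ?h ^ Suc k" by (simp add: algebra_simps)
  finally show ?case .
qed

text \<open>
  Markov's inequality bounds the probability of a draw beyond the cut-off by the tail expectation, and
  \<open>exp u \<le> 1 + u + u\<^sup>2\<close> applies to the remaining draws since \<open>\<theta> * L \<le> 1\<close>.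
\<close>

lemma product_pmf_right_tail:
  assumes p: "set_pmf p \<subseteq> {1..}" and int: "integrable p (\<lambda>m. ln (real m))"
    and \<theta>: "0 \<le> \<theta>" and L: "0 < L" and \<theta>L: "\<theta> * L \<le> 1"
  shows "measure_pmf.prob (product_pmf p k) {m. ln (real m) > x} \<le>
    real k * measure_pmf.expectation p (\<lambda>m. ln (real m) * indicat_real {m. ln (real m) > L} m) / L +
    exp (- \<theta> * x + real k * \<theta> * (1 + \<theta> * L) * measure_pmf.expectation p (\<lambda>m. ln (real m)))"
proof -
  let ?E = "measure_pmf.expectation p"
  let ?h = "\<lambda>m. exp (\<theta> * ln (real m)) * indicat_real {m. ln (real m) \<le> L} m"
  let ?T = "\<lambda>m. ln (real m) * indicat_real {m. ln (real m) > L} m"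
  have intT: "integrable p ?T" using int by (intro integrable_real_mult_indicator) auto
  have "L * measure_pmf.prob p {m. ln (real m) > L} = ?E (\<lambda>m. L * indicat_real {m. ln (real m) > L} m)"
    by simp
  also have "\<dots> \<le> ?E ?T"
  proof (rule integral_mono)
    show "integrable p (\<lambda>m. L * indicat_real {m. ln (real m) > L} m)"
      by (intro integrable_mult_right) (auto intro: integrable_pmf_unit)
  qed (use intT in \<open>auto simp: indicator_def\<close>)
  finally have tail: "measure_pmf.prob p {m. ln (real m) > L} \<le> ?E ?T / L"
    using L by (simp add: field_simps)
  have h: "?h m \<le> 1 + \<theta> * (1 + \<theta> * L) * ln (real m)" if "m \<in> set_pmf p" for m
  proof -
    have "1 \<le> m" using that p by auto
    then have y: "0 \<le> ln (real m)" by simp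
    show ?thesis
    proof (cases "ln (real m) \<le> L")
      case True
      have "\<theta> * ln (real m) \<le> \<theta> * L" using True \<theta> by (intro mult_left_mono)
      then have "exp (\<theta> * ln (real m)) \<le> 1 + \<theta> * ln (real m) + (\<theta> * ln (real m))\<^sup>2"
        using \<theta> \<theta>L y by (intro exp_bound) auto
      also have "(\<theta> * ln (real m))\<^sup>2 \<le> \<theta>\<^sup>2 * L * ln (real m)"
        using mult_left_mono[OF mult_right_mono[OF True y], of "\<theta>\<^sup>2"]
        by (simp add: power2_eq_square mult_ac)
      finally show ?thesis using True by (simp add: power2_eq_square algebra_simps)
    next
      case False
      then show ?thesis using \<theta> y L by simp
    qed
  qed
  have int_h: "integrable p ?h"
    using \<theta> by (intro measure_pmf.integrable_const_bound[where B = "exp (\<theta> * L)"])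
      (auto simp: indicator_def mult_left_mono)
  have "?E ?h \<le> ?E (\<lambda>m. 1 + \<theta> * (1 + \<theta> * L) * ln (real m))"
    using int int_h h by (intro integral_mono_AE) (auto simp: AE_measure_pmf_iff)
  also have "\<dots> = 1 + \<theta> * (1 + \<theta> * L) * ?E (\<lambda>m. ln (real m))"
    using int by (subst Bochner_Integration.integral_add) auto
  also have "\<dots> \<le> exp (\<theta> * (1 + \<theta> * L) * ?E (\<lambda>m. ln (real m)))"
    by (rule exp_ge_add_one_self)
  finally have "?E ?h ^ k \<le> exp (\<theta> * (1 + \<theta> * L) * ?E (\<lambda>m. ln (real m))) ^ k"
    by (intro power_mono) auto
  also have "\<dots> = exp (real k * \<theta> * (1 + \<theta> * L) * ?E (\<lambda>m. ln (real m)))"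
    by (simp add: exp_of_nat_mult[symmetric] mult_ac)
  finally have "exp (- \<theta> * x) * ?E ?h ^ k \<le> exp (- \<theta> * x) * exp (real k * \<theta> * (1 + \<theta> * L) * ?E (\<lambda>m. ln (real m)))"
    by (intro mult_left_mono) auto
  moreover have "real k * measure_pmf.prob p {m. ln (real m) > L} \<le> real k * ?E ?T / L"
    using mult_left_mono[OF tail, of "real k"] by simp
  ultimately show ?thesis
    using product_pmf_right_tail_aux[OF p \<theta>, of k x L] unfolding exp_add by linarith
qed

section \<open>Total variation bounds\<close>

lemma conv_power_sum_eq_expectation:
  assumes p: "set_pmf p \<subseteq> {1..}" and A: "A \<subseteq> S n"
  shows "(\<Sum>\<sigma>\<in>A. conv_power n (p_shuffle n p) k \<sigma>) =
    measure_pmf.expectation (product_pmf p k) (\<lambda>m. \<Sum>\<sigma>\<in>A. m_shuffle n m \<sigma>)"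
    and "integrable (product_pmf p k) (\<lambda>m. \<Sum>\<sigma>\<in>A. m_shuffle n m \<sigma>)"
proof -
  have int: "integrable (product_pmf p k) (\<lambda>m. m_shuffle n m \<sigma>)" if "\<sigma> \<in> A" for \<sigma>
    using that A by (intro integrable_pmf_unit m_shuffle_nonneg m_shuffle_le_1) auto
  then show "integrable (product_pmf p k) (\<lambda>m. \<Sum>\<sigma>\<in>A. m_shuffle n m \<sigma>)" by simp
  have "(\<Sum>\<sigma>\<in>A. conv_power n (p_shuffle n p) k \<sigma>) =
    (\<Sum>\<sigma>\<in>A. measure_pmf.expectation (product_pmf p k) (\<lambda>m. m_shuffle n m \<sigma>))"
    using A p by (intro sum.cong) (auto simp: conv_power_eq_expectation)
  also have "\<dots> = measure_pmf.expectation (product_pmf p k) (\<lambda>m. \<Sum>\<sigma>\<in>A. m_shuffle n m \<sigma>)"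
    using int by (simp add: Bochner_Integration.integral_sum)
  finally show "(\<Sum>\<sigma>\<in>A. conv_power n (p_shuffle n p) k \<sigma>) = \<dots>" .
qed

lemma sum_conv_power:
  assumes p: "set_pmf p \<subseteq> {1..}"
  shows "(\<Sum>\<sigma>\<in>S n. conv_power n (p_shuffle n p) k \<sigma>) = 1"
proof -
  have "measure_pmf.expectation (product_pmf p k) (\<lambda>m. \<Sum>\<sigma>\<in>S n. m_shuffle n m \<sigma>) =
      measure_pmf.expectation (product_pmf p k) (\<lambda>m. 1)"
    using set_product_pmf[OF p, of k]
    by (intro integral_cong_AE AE_pmfI) (auto intro!: sum_m_shuffle)
  then show ?thesis using conv_power_sum_eq_expectation(1)[OF p, of "S n" n k] by simp
qed

lemma tv_norm_ge:
  assumes "A \<subseteq> S n"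
  shows "(\<Sum>\<sigma>\<in>A. P \<sigma>) - (\<Sum>\<sigma>\<in>A. Q \<sigma>) \<le> tv_norm n P Q"
  unfolding tv_norm_def using assms by (intro cSUP_upper bdd_above_finite) auto

lemma tv_norm_le:
  assumes "\<And>A. A \<subseteq> S n \<Longrightarrow> (\<Sum>\<sigma>\<in>A. P \<sigma>) - (\<Sum>\<sigma>\<in>A. Q \<sigma>) \<le> B"
  shows "tv_norm n P Q \<le> B"
  unfolding tv_norm_def using assms by (intro cSUP_least) auto

lemma tv_norm_bounds:
  assumes p: "set_pmf p \<subseteq> {1..}"
  shows "0 \<le> tv_norm n (conv_power n (p_shuffle n p) k) (uniform_mass n)"
    and "tv_norm n (conv_power n (p_shuffle n p) k) (uniform_mass n) \<le> 1"
proof -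
  show "0 \<le> tv_norm n (conv_power n (p_shuffle n p) k) (uniform_mass n)"
    using tv_norm_ge[of "{}" n] by simp
  show "tv_norm n (conv_power n (p_shuffle n p) k) (uniform_mass n) \<le> 1"
  proof (rule tv_norm_le)
    fix A assume A: "A \<subseteq> S n"
    have "(\<Sum>\<sigma>\<in>A. conv_power n (p_shuffle n p) k \<sigma>) \<le> (\<Sum>\<sigma>\<in>S n. conv_power n (p_shuffle n p) k \<sigma>)"
      using A p by (intro sum_mono2) (auto simp: conv_power_eq_expectation m_shuffle_nonneg)
    moreover have "0 \<le> (\<Sum>\<sigma>\<in>A. uniform_mass n \<sigma>)" by (simp add: uniform_mass_def)
    ultimately show "(\<Sum>\<sigma>\<in>A. conv_power n (p_shuffle n p) k \<sigma>) - (\<Sum>\<sigma>\<in>A. uniform_mass n \<sigma>) \<le> 1"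
      using sum_conv_power[OF p, of n k] by linarith
  qed
qed

text \<open>
  The bound for a single \<open>m\<close> decreases in \<open>m\<close>, so for \<open>ln m > x\<close> it may be evaluated at \<open>exp x\<close>; on the
  remaining event the excess is at most \<open>1\<close>.
\<close>

lemma tv_norm_upper:
  assumes p: "set_pmf p \<subseteq> {1..}" and n: "1 \<le> n" and x: "2 * real n \<le> exp x"
  shows "tv_norm n (conv_power n (p_shuffle n p) k) (uniform_mass n) \<le>
    measure_pmf.prob (product_pmf p k) {m. ln (real m) \<le> x} +
    real n * sqrt (real n) / exp x + 2 * real n ^ 3 / (exp x)\<^sup>2"
proof (rule tv_norm_le)
  fix A assume A: "A \<subseteq> S n"
  let ?Z = "product_pmf p k"
  let ?B = "real n * sqrt (real n) / exp x + 2 * real n ^ 3 / (exp x)\<^sup>2"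
  let ?U = "\<Sum>\<sigma>\<in>A. uniform_mass n \<sigma>"
  note E = conv_power_sum_eq_expectation[OF p A, of k]
  have B: "0 \<le> ?B" by simp
  have "(\<Sum>\<sigma>\<in>A. conv_power n (p_shuffle n p) k \<sigma>) - ?U =
      measure_pmf.expectation ?Z (\<lambda>m. (\<Sum>\<sigma>\<in>A. m_shuffle n m \<sigma>) - ?U)"
    using E by (subst Bochner_Integration.integral_diff) auto
  also have "\<dots> \<le> measure_pmf.expectation ?Z (\<lambda>m. indicat_real {m. ln (real m) \<le> x} m + ?B)"
  proof (rule integral_mono_AE)
    show "integrable ?Z (\<lambda>m. (\<Sum>\<sigma>\<in>A. m_shuffle n m \<sigma>) - ?U)" using E(2) by simp
    show "integrable ?Z (\<lambda>m. indicat_real {m. ln (real m) \<le> x} m + ?B)"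
      by (intro Bochner_Integration.integrable_add) (auto intro: integrable_pmf_unit)
    show "AE m in ?Z. (\<Sum>\<sigma>\<in>A. m_shuffle n m \<sigma>) - ?U \<le> indicat_real {m. ln (real m) \<le> x} m + ?B"
    proof (rule AE_pmfI)
      fix m assume "m \<in> set_pmf ?Z"
      then have m: "1 \<le> m" using set_product_pmf[OF p, of k] by auto
      show "(\<Sum>\<sigma>\<in>A. m_shuffle n m \<sigma>) - ?U \<le> indicat_real {m. ln (real m) \<le> x} m + ?B"
      proof (cases "ln (real m) \<le> x")
        case True
        have "(\<Sum>\<sigma>\<in>A. m_shuffle n m \<sigma>) \<le> (\<Sum>\<sigma>\<in>S n. m_shuffle n m \<sigma>)"
          using A by (intro sum_mono2) (auto simp: m_shuffle_nonneg)
        moreover have "0 \<le> ?U" by (simp add: uniform_mass_def)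
        moreover have "indicat_real {m. ln (real m) \<le> x} m = 1" using True by simp
        ultimately show ?thesis using B sum_m_shuffle[OF m, of n] by linarith
      next
        case False
        then have em: "exp x \<le> real m" using m by (simp add: ln_ge_iff[symmetric])
        then have "2 * n \<le> m" using x by linarith
        from m_shuffle_excess_le[OF n this A]
        have "(\<Sum>\<sigma>\<in>A. m_shuffle n m \<sigma>) - ?U \<le> real n * sqrt (real n) / real m + 2 * real n ^ 3 / (real m)\<^sup>2" .
        also have "\<dots> \<le> ?B"
          using em m by (intro add_mono divide_left_mono power_mono) auto
        finally show ?thesis using False by simp
      qed
    qed
  qed
  also have "\<dots> = measure_pmf.prob ?Z {m. ln (real m) \<le> x} + ?B"
    by (subst Bochner_Integration.integral_add) (auto intro: integrable_pmf_unit)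
  finally show "(\<Sum>\<sigma>\<in>A. conv_power n (p_shuffle n p) k \<sigma>) - ?U \<le>
      measure_pmf.prob ?Z {m. ln (real m) \<le> x} + real n * sqrt (real n) / exp x + 2 * real n ^ 3 / (exp x)\<^sup>2"
    by simp
qed

text \<open>
  The test event is that the deficit exceeds the threshold for \<open>M = exp x\<close>. The constant is
  \<open>192 + 36864\<close>: the first part from \<open>exp (- z) \<le> 1 / z\<close> for the shuffle, the second from Chebyshev's
  inequality for the uniform law, both after \<open>M + n \<le> 2 * M\<close>.
\<close>

lemma tv_norm_lower:
  assumes p: "set_pmf p \<subseteq> {1..}" and n: "2 \<le> n" and x: "real n \<le> exp x"
  shows "tv_norm n (conv_power n (p_shuffle n p) k) (uniform_mass n) \<ge>
    1 - measure_pmf.prob (product_pmf p k) {m. ln (real m) > x} - 37056 * ((exp x)\<^sup>2 / real n ^ 3)"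
proof -
  let ?Z = "product_pmf p k" and ?M = "exp x"
  let ?P = "conv_power n (p_shuffle n p) k"
  let ?s = "deficit_threshold n ?M"
  let ?A = "{\<sigma> \<in> S n. centred_deficit n \<sigma> > ?s}" and ?B = "{\<sigma> \<in> S n. centred_deficit n \<sigma> \<le> ?s}"
  let ?e = "exp (- (real n ^ 3 / (96 * ?M * (?M + real n))))"
  let ?v = "?M\<^sup>2 / real n ^ 3"
  have v: "0 < ?v" using n by simp
  have "(\<Sum>\<sigma>\<in>?B. ?P \<sigma>) = measure_pmf.expectation ?Z (\<lambda>m. \<Sum>\<sigma>\<in>?B. m_shuffle n m \<sigma>)"
    by (rule conv_power_sum_eq_expectation[OF p]) auto
  also have "\<dots> \<le> measure_pmf.expectation ?Z (\<lambda>m. indicat_real {m. ln (real m) > x} m + ?e)"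
  proof (rule integral_mono_AE)
    show "integrable ?Z (\<lambda>m. \<Sum>\<sigma>\<in>?B. m_shuffle n m \<sigma>)"
      by (rule conv_power_sum_eq_expectation[OF p]) auto
    show "integrable ?Z (\<lambda>m. indicat_real {m. ln (real m) > x} m + ?e)"
      by (intro Bochner_Integration.integrable_add) (auto intro: integrable_pmf_unit)
    show "AE m in ?Z. (\<Sum>\<sigma>\<in>?B. m_shuffle n m \<sigma>) \<le> indicat_real {m. ln (real m) > x} m + ?e"
    proof (rule AE_pmfI)
      fix m assume "m \<in> set_pmf ?Z"
      then have m: "1 \<le> m" using set_product_pmf[OF p, of k] by auto
      show "(\<Sum>\<sigma>\<in>?B. m_shuffle n m \<sigma>) \<le> indicat_real {m. ln (real m) > x} m + ?e"
      proof (cases "ln (real m) > x")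
        case True
        have "(\<Sum>\<sigma>\<in>?B. m_shuffle n m \<sigma>) \<le> (\<Sum>\<sigma>\<in>S n. m_shuffle n m \<sigma>)"
          by (intro sum_mono2) (auto simp: m_shuffle_nonneg)
        then have "(\<Sum>\<sigma>\<in>?B. m_shuffle n m \<sigma>) \<le> 1" using sum_m_shuffle[OF m, of n] by linarith
        also have "\<dots> \<le> 1 + ?e" by simp
        finally show ?thesis using True by simp
      next
        case False
        then have "real m \<le> ?M" using m by (metis exp_le_cancel_iff exp_ln not_less of_nat_0_less_iff One_nat_def Suc_le_lessD)
        then show ?thesis using m_shuffle_small_deficit[OF n m] False by simp
      qed
    qed
  qed
  also have "\<dots> = measure_pmf.prob ?Z {m. ln (real m) > x} + ?e"
    by (subst Bochner_Integration.integral_add) (auto intro: integrable_pmf_unit)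
  finally have PB: "(\<Sum>\<sigma>\<in>?B. ?P \<sigma>) \<le> measure_pmf.prob ?Z {m. ln (real m) > x} + ?e" .
  have Mn: "?M + real n \<le> 2 * ?M" using x by simp
  have e: "?e \<le> 192 * ?v"
  proof -
    have "96 * ?M * (?M + real n) \<le> 96 * ?M * (2 * ?M)" using Mn by (intro mult_left_mono) auto
    then have le: "real n ^ 3 / (96 * ?M * (2 * ?M)) \<le> real n ^ 3 / (96 * ?M * (?M + real n))"
      using n by (intro divide_left_mono mult_pos_pos add_pos_nonneg) auto
    have "inverse (192 * ?v) = real n ^ 3 / (96 * ?M * (2 * ?M))"
      by (simp add: power2_eq_square field_simps)
    also note le
    finally have z: "inverse (192 * ?v) \<le> real n ^ 3 / (96 * ?M * (?M + real n))" (is "_ \<le> ?z") .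
    have "inverse (192 * ?v) \<le> exp ?z" using z exp_ge_add_one_self[of ?z] by linarith
    moreover have "0 < inverse (192 * ?v)" using v by (simp only: inverse_positive_iff_positive)
    ultimately have "inverse (exp ?z) \<le> inverse (inverse (192 * ?v))" by (rule le_imp_inverse_le)
    then show ?thesis by (simp only: exp_minus inverse_inverse_eq)
  qed
  have U: "(\<Sum>\<sigma>\<in>?A. uniform_mass n \<sigma>) \<le> 36864 * ?v"
  proof -
    have "real n / ?s\<^sup>2 = 9216 * (?M + real n)\<^sup>2 / real n ^ 3"
      using n by (simp add: deficit_threshold_def power2_eq_square power3_eq_cube field_simps)
    also have "\<dots> \<le> 9216 * (2 * ?M)\<^sup>2 / real n ^ 3"
      using Mn by (intro divide_right_mono mult_left_mono power_mono) auto
    finally show ?thesis using uniform_large_deficit[OF n, of ?M] by (simp add: power_mult_distrib)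
  qed
  have "?A = S n - ?B" by auto
  then have "(\<Sum>\<sigma>\<in>?A. ?P \<sigma>) = 1 - (\<Sum>\<sigma>\<in>?B. ?P \<sigma>)"
    using sum_diff[of "S n" ?B ?P] sum_conv_power[OF p, of n k] by simp
  moreover have "(\<Sum>\<sigma>\<in>?A. ?P \<sigma>) - (\<Sum>\<sigma>\<in>?A. uniform_mass n \<sigma>) \<le> tv_norm n ?P (uniform_mass n)"
    by (rule tv_norm_ge) auto
  ultimately show ?thesis using PB e U by linarith
qed

section \<open>Concentration of the product on the logarithmic scale\<close>

lemma exp_times_less:
  fixes c e :: real
  assumes "0 < c" "0 < e"
  obtains \<kappa> where "0 < \<kappa>" "exp (- \<kappa> * c) < e"
proof
  show "0 < (1 + \<bar>ln e\<bar>) / c" using assms by (simp add: add_pos_nonneg)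
  have "- ((1 + \<bar>ln e\<bar>) / c) * c = - 1 - \<bar>ln e\<bar>" using assms by simp
  also have "\<dots> < ln e" by linarith
  finally have "exp (- ((1 + \<bar>ln e\<bar>) / c) * c) < exp (ln e)" by (simp only: exp_less_cancel_iff)
  then show "exp (- ((1 + \<bar>ln e\<bar>) / c) * c) < e" using assms by simp
qed

text \<open>
  The exponent of the left tail bound at rate \<open>\<kappa> / ln n\<close> is at most
  \<open>\<kappa> * (a - (1 - d)\<^sup>2 * b)\<close>, where \<open>d\<close> covers both the relative loss \<open>\<kappa> * \<eta>\<close> of the quadratic term and
  the mean lost by the cut-off. Once \<open>d\<close> is small this tends to minus infinity with \<open>\<kappa>\<close>.
\<close>

lemma product_pmf_lower_concentration:
  fixes p :: "nat \<Rightarrow> nat pmf" and \<mu> :: "nat \<Rightarrow> real" and k :: "nat \<Rightarrow> nat"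
  assumes p: "\<And>n. n \<ge> 1 \<Longrightarrow> set_pmf (p n) \<subseteq> {1..}"
    and int: "\<And>n. n \<ge> 1 \<Longrightarrow> integrable (p n) (\<lambda>m. ln (real m))"
    and \<mu>: "\<And>n. n \<ge> 1 \<Longrightarrow> \<mu> n = measure_pmf.expectation (p n) (\<lambda>m. ln (real m))"
    and \<mu>_pos: "\<And>n. n \<ge> 1 \<Longrightarrow> \<mu> n > 0"
    and tail: "\<And>\<eta>. \<eta> > 0 \<Longrightarrow> (\<lambda>n. measure_pmf.expectation (p n)
      (\<lambda>m. ln (real m) * indicat_real {m. ln (real m) > \<eta> * ln (real n)} m)) \<in> o(\<mu>)"
    and ab: "0 < a" "a < b"
    and k: "\<forall>\<^sub>F n in sequentially. b * ln (real n) \<le> real (k n) * \<mu> n"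
  shows "(\<lambda>n. measure_pmf.prob (product_pmf (p n) (k n)) {m. ln (real m) \<le> a * ln (real n)}) \<longlonglongrightarrow> 0"
proof (rule tendstoI)
  fix e :: real assume "0 < e"
  then obtain \<kappa> where \<kappa>: "0 < \<kappa>" "exp (- \<kappa> * ((b - a) / 2)) < e"
    using exp_times_less[of "(b - a) / 2" e] ab by auto
  \<comment> \<open>Small enough that losing the factor \<open>1 - d\<close> twice leaves \<open>b\<close> above the midpoint of \<open>a\<close> and \<open>b\<close>.\<close>
  define d where "d = (b - a) / (4 * b)"
  define \<eta> where "\<eta> = d / \<kappa>"
  have d: "0 < d" "d < 1" using ab by (auto simp: d_def field_simps)
  have \<eta>: "0 < \<eta>" using d \<kappa> by (simp add: \<eta>_def)
  have db: "(a + b) / 2 \<le> (1 - d) * ((1 - d) * b)"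
  proof -
    have expand: "(1 - d) * ((1 - d) * b) = b - 2 * (d * b) + d\<^sup>2 * b"
      by (simp add: power2_eq_square algebra_simps)
    have db: "d * b = (b - a) / 4" using ab by (simp add: d_def)
    have "0 \<le> d\<^sup>2 * b" using ab by simp
    then show ?thesis unfolding expand db by (simp add: field_simps)
  qed
  define T where "T n = measure_pmf.expectation (p n)
      (\<lambda>m. ln (real m) * indicat_real {m. ln (real m) > \<eta> * ln (real n)} m)" for n
  have "\<forall>\<^sub>F n in sequentially. norm (T n) \<le> d * norm (\<mu> n)"
    using landau_o.smallD[OF tail[OF \<eta>] d(1)] by (simp add: T_def)
  then show "\<forall>\<^sub>F n in sequentially.
      dist (measure_pmf.prob (product_pmf (p n) (k n)) {m. ln (real m) \<le> a * ln (real n)}) 0 < e"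
    using k eventually_ge_at_top[of 2]
  proof eventually_elim
    case (elim n)
    define l where "l = ln (real n)"
    have l: "0 < l" using elim by (simp add: l_def)
    have n: "n \<ge> 1" using elim by simp
    let ?L = "\<eta> * l" and ?\<theta> = "\<kappa> / l"
    let ?\<nu> = "measure_pmf.expectation (p n) (\<lambda>m. ln (real m) * indicat_real {m. ln (real m) \<le> ?L} m)"
    have i1: "integrable (p n) (\<lambda>m. ln (real m) * indicat_real {m. ln (real m) \<le> ?L} m)"
      and i2: "integrable (p n) (\<lambda>m. ln (real m) * indicat_real {m. ln (real m) > ?L} m)"
      by (rule integrable_real_mult_indicator[OF _ int[OF n]]; simp)+
    have "\<mu> n = measure_pmf.expectation (p n) (\<lambda>m. ln (real m) * indicat_real {m. ln (real m) \<le> ?L} m +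
        ln (real m) * indicat_real {m. ln (real m) > ?L} m)"
      unfolding \<mu>[OF n] by (intro Bochner_Integration.integral_cong) (auto simp: indicator_def)
    also have "\<dots> = ?\<nu> + T n"
      unfolding T_def l_def[symmetric] by (rule Bochner_Integration.integral_add[OF i1 i2])
    finally have "(1 - d) * \<mu> n \<le> ?\<nu>"
      using elim(1) \<mu>_pos[OF n] by (simp add: algebra_simps)
    then have "real (k n) * ((1 - d) * \<mu> n) \<le> real (k n) * ?\<nu>" by (intro mult_left_mono) auto
    moreover have "(1 - d) * (b * l) \<le> (1 - d) * (real (k n) * \<mu> n)"
      using elim(2) d by (intro mult_left_mono) (auto simp: l_def)
    ultimately have "(1 - d) * (b * l) \<le> real (k n) * ?\<nu>" by (simp add: mult_ac)
    then have "(1 - d) * ((1 - d) * (b * l)) \<le> (1 - d) * (real (k n) * ?\<nu>)"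
      using d by (intro mult_left_mono) auto
    moreover have "(a + b) / 2 * l \<le> (1 - d) * ((1 - d) * (b * l))"
      using mult_right_mono[OF db less_imp_le[OF l]] by (simp only: mult.assoc)
    ultimately have "(a + b) / 2 * l \<le> (1 - d) * (real (k n) * ?\<nu>)" by linarith
    then have "?\<theta> * ((a + b) / 2 * l) \<le> ?\<theta> * ((1 - d) * (real (k n) * ?\<nu>))"
      using \<kappa> l by (intro mult_left_mono) auto
    moreover have "?\<theta> * ((a + b) / 2 * l) = \<kappa> * ((a + b) / 2)" using l by simp
    moreover have "?\<theta> * (a * l) = \<kappa> * a" using l by simp
    moreover have "\<kappa> * ((a + b) / 2) - \<kappa> * a = \<kappa> * ((b - a) / 2)" by (simp add: field_simps)
    ultimately have bound: "?\<theta> * (a * l) - ?\<theta> * ((1 - d) * (real (k n) * ?\<nu>)) \<le> - \<kappa> * ((b - a) / 2)"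
      by linarith
    have "?\<theta> * ?L = d" using \<kappa> l by (simp add: \<eta>_def)
    then have "measure_pmf.prob (product_pmf (p n) (k n)) {m. ln (real m) \<le> a * l} \<le>
        exp (?\<theta> * (a * l) - real (k n) * ?\<theta> * (1 - d) * ?\<nu>)"
      using product_pmf_left_tail[OF p[OF n] int[OF n], of ?\<theta> ?L "k n" "a * l"] \<kappa> l \<eta> by simp
    also have "real (k n) * ?\<theta> * (1 - d) * ?\<nu> = ?\<theta> * ((1 - d) * (real (k n) * ?\<nu>))" by simp
    also have "exp (?\<theta> * (a * l) - ?\<theta> * ((1 - d) * (real (k n) * ?\<nu>))) \<le> exp (- \<kappa> * ((b - a) / 2))"
      using bound by (simp only: exp_le_cancel_iff)
    also have "\<dots> < e" by (rule \<kappa>(2))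
    finally show ?case by (simp add: l_def)
  qed
qed

text \<open>
  Draws beyond the cut-off \<open>\<eta> * ln n\<close> occur with probability at most \<open>k * T / (\<eta> * ln n)\<close>, where the
  tail expectation \<open>T\<close> is \<open>o(\<mu>)\<close> and \<open>k * \<mu>\<close> is at most \<open>a * ln n\<close>. The other draws are handled by the
  exponential moment.
\<close>

lemma product_pmf_upper_concentration:
  fixes p :: "nat \<Rightarrow> nat pmf" and \<mu> :: "nat \<Rightarrow> real" and k :: "nat \<Rightarrow> nat"
  assumes p: "\<And>n. n \<ge> 1 \<Longrightarrow> set_pmf (p n) \<subseteq> {1..}"
    and int: "\<And>n. n \<ge> 1 \<Longrightarrow> integrable (p n) (\<lambda>m. ln (real m))"
    and \<mu>: "\<And>n. n \<ge> 1 \<Longrightarrow> \<mu> n = measure_pmf.expectation (p n) (\<lambda>m. ln (real m))"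
    and \<mu>_pos: "\<And>n. n \<ge> 1 \<Longrightarrow> \<mu> n > 0"
    and tail: "\<And>\<eta>. \<eta> > 0 \<Longrightarrow> (\<lambda>n. measure_pmf.expectation (p n)
      (\<lambda>m. ln (real m) * indicat_real {m. ln (real m) > \<eta> * ln (real n)} m)) \<in> o(\<mu>)"
    and ab: "0 < a" "a < b"
    and k: "\<forall>\<^sub>F n in sequentially. real (k n) * \<mu> n \<le> a * ln (real n)"
  shows "(\<lambda>n. measure_pmf.prob (product_pmf (p n) (k n)) {m. ln (real m) > b * ln (real n)}) \<longlonglongrightarrow> 0"
proof (rule tendstoI)
  fix e :: real assume e: "0 < e"
  then obtain \<kappa> where \<kappa>: "0 < \<kappa>" "exp (- \<kappa> * ((b - a) / 2)) < e / 2"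
    using exp_times_less[of "(b - a) / 2" "e / 2"] ab by auto
  \<comment> \<open>Small enough that the factor \<open>1 + d\<close> keeps \<open>a\<close> below the midpoint of \<open>a\<close> and \<open>b\<close>.\<close>
  define d where "d = min 1 ((b - a) / (2 * a))"
  define \<eta> where "\<eta> = d / \<kappa>"
  have d: "0 < d" "d \<le> 1" using ab by (auto simp: d_def)
  have \<eta>: "0 < \<eta>" using d \<kappa> by (simp add: \<eta>_def)
  have da: "(1 + d) * a \<le> (a + b) / 2"
  proof -
    have "d * a \<le> (b - a) / (2 * a) * a" using ab by (intro mult_right_mono) (auto simp: d_def)
    also have "\<dots> = (b - a) / 2" using ab by simp
    finally show ?thesis by (simp add: distrib_right field_simps)
  qed
  \<comment> \<open>Chosen so that draws beyond the cut-off occur with probability at most \<open>e / 2\<close>.\<close>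
  define \<delta> where "\<delta> = e * \<eta> / (2 * a)"
  have \<delta>: "0 < \<delta>" using e \<eta> ab by (simp add: \<delta>_def)
  define T where "T n = measure_pmf.expectation (p n)
      (\<lambda>m. ln (real m) * indicat_real {m. ln (real m) > \<eta> * ln (real n)} m)" for n
  have "\<forall>\<^sub>F n in sequentially. norm (T n) \<le> \<delta> * norm (\<mu> n)"
    using landau_o.smallD[OF tail[OF \<eta>] \<delta>] by (simp add: T_def)
  then show "\<forall>\<^sub>F n in sequentially.
      dist (measure_pmf.prob (product_pmf (p n) (k n)) {m. ln (real m) > b * ln (real n)}) 0 < e"
    using k eventually_ge_at_top[of 2]
  proof eventually_elim
    case (elim n)
    define l where "l = ln (real n)"
    have l: "0 < l" using elim by (simp add: l_def)
    have n: "n \<ge> 1" using elim by simp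
    let ?L = "\<eta> * l" and ?\<theta> = "\<kappa> / l"
    have k\<mu>: "real (k n) * \<mu> n \<le> a * l" using elim(2) by (simp add: l_def)
    have "real (k n) * T n \<le> real (k n) * (\<delta> * \<mu> n)"
      using elim(1) \<mu>_pos[OF n] by (intro mult_left_mono) auto
    also have "\<dots> = \<delta> * (real (k n) * \<mu> n)" by simp
    also have "\<dots> \<le> \<delta> * (a * l)" using k\<mu> \<delta> by (intro mult_left_mono) auto
    also have "\<dots> = e / 2 * ?L" using ab by (simp add: \<delta>_def)
    finally have jumps: "real (k n) * T n / ?L \<le> e / 2"
      using \<eta> l by (simp add: divide_le_eq)
    have "?\<theta> * ((1 + d) * (real (k n) * \<mu> n)) \<le> ?\<theta> * ((1 + d) * (a * l))"
      using k\<mu> \<kappa> l d by (intro mult_left_mono) auto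
    also have "\<dots> = \<kappa> * ((1 + d) * a)" using l by simp
    also have "\<dots> \<le> \<kappa> * ((a + b) / 2)" using da \<kappa> by (intro mult_left_mono) auto
    finally have "?\<theta> * ((1 + d) * (real (k n) * \<mu> n)) \<le> \<kappa> * ((a + b) / 2)" .
    moreover have "- ?\<theta> * (b * l) = - (\<kappa> * b)" using l by simp
    moreover have "\<kappa> * ((a + b) / 2) - \<kappa> * b = - \<kappa> * ((b - a) / 2)" by (simp add: field_simps)
    ultimately have bound: "- ?\<theta> * (b * l) + ?\<theta> * ((1 + d) * (real (k n) * \<mu> n)) \<le> - \<kappa> * ((b - a) / 2)"
      by linarith
    have \<theta>L: "?\<theta> * ?L = d" using \<kappa> l by (simp add: \<eta>_def)
    have "measure_pmf.prob (product_pmf (p n) (k n)) {m. ln (real m) > b * l} \<le>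
        real (k n) * T n / ?L + exp (- ?\<theta> * (b * l) + real (k n) * ?\<theta> * (1 + ?\<theta> * ?L) * \<mu> n)"
      unfolding \<mu>[OF n] T_def l_def[symmetric]
      using \<kappa> l \<eta> d(2) \<theta>L by (intro product_pmf_right_tail[OF p[OF n] int[OF n]]) auto
    also have "real (k n) * ?\<theta> * (1 + ?\<theta> * ?L) * \<mu> n = ?\<theta> * ((1 + d) * (real (k n) * \<mu> n))"
      unfolding \<theta>L by simp
    also have "exp (- ?\<theta> * (b * l) + ?\<theta> * ((1 + d) * (real (k n) * \<mu> n))) \<le> exp (- \<kappa> * ((b - a) / 2))"
      using bound by (simp only: exp_le_cancel_iff)
    finally have "measure_pmf.prob (product_pmf (p n) (k n)) {m. ln (real m) > b * l} < e"
      using \<kappa>(2) jumps by linarith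
    then show ?case by (simp add: l_def)
  qed
qed

section \<open>The cutoff\<close>

lemma tendsto_exp_neg_ln:
  fixes c :: real
  assumes "0 < c"
  shows "(\<lambda>n. exp (- c * ln (real n))) \<longlonglongrightarrow> 0"
proof -
  have "filterlim (\<lambda>n. c * ln (real n)) at_top sequentially"
    by (intro filterlim_tendsto_pos_mult_at_top[OF tendsto_const assms]
        filterlim_compose[OF ln_at_top] filterlim_real_sequentially)
  then have "filterlim (\<lambda>n. - (c * ln (real n))) at_bot sequentially"
    by (simp add: filterlim_uminus_at_bot)
  then show ?thesis using filterlim_compose[OF exp_at_bot] by fastforce
qed

lemma exp_three_halves_ln:
  assumes "1 \<le> n"
  shows "exp (3 / 2 * ln (real n)) = real n * sqrt (real n)" "exp (3 * ln (real n)) = real n ^ 3"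
proof -
  have n: "0 < real n" using assms by simp
  have "3 / 2 * ln (real n) = ln (real n) + ln (sqrt (real n))" using n by (simp add: ln_sqrt)
  then show "exp (3 / 2 * ln (real n)) = real n * sqrt (real n)"
    unfolding \<open>3 / 2 * ln (real n) = _\<close> exp_add using n by simp
  show "exp (3 * ln (real n)) = real n ^ 3"
    using n exp_of_nat_mult[of 3 "ln (real n)"] by simp
qed

theorem theorem3p5:
  fixes p :: "nat \<Rightarrow> nat pmf"
    and M :: "nat \<Rightarrow> 'a measure"
    and X :: "nat \<Rightarrow> 'a \<Rightarrow> nat"
    and \<mu> :: "nat \<Rightarrow> real"
  assumes "\<And>n. n \<ge> 1 \<Longrightarrow> set_pmf (p n) \<subseteq> {1..}"
    and "\<And>n. n \<ge> 1 \<Longrightarrow> prob_space (M n)"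
    and "\<And>n. n \<ge> 1 \<Longrightarrow> X n \<in> measurable (M n) (count_space UNIV)"
    and "\<And>n. n \<ge> 1 \<Longrightarrow> distr (M n) (count_space UNIV) (X n) = measure_pmf (p n)"
    and "\<And>n. n \<ge> 1 \<Longrightarrow> integrable (M n) (\<lambda>\<omega>. ln (real (X n \<omega>)))"
    and "\<And>n. n \<ge> 1 \<Longrightarrow> \<mu> n = (\<integral>\<omega>. ln (real (X n \<omega>)) \<partial>M n)"
    and "\<And>n. n \<ge> 1 \<Longrightarrow> \<mu> n > 0"
    and "\<mu> \<in> o(\<lambda>n. ln (real n))"
    and "\<And>\<eta> :: real. \<eta> > 0 \<Longrightarrow>
      (\<lambda>n. \<integral>\<omega>. ln (real (X n \<omega>)) *
              indicat_real {\<omega>. ln (real (X n \<omega>)) > \<eta> * ln (real n)} \<omega> \<partial>M n) \<in> o(\<mu>)"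
  shows "tv_cutoff (\<lambda>n. p_shuffle n (p n)) (\<lambda>n. 3 * ln (real n) / (2 * \<mu> n))"
proof -
  note p = assms(1) and \<mu>_pos = assms(7)
  let ?tv = "\<lambda>k n. tv_norm n (conv_power n (p_shuffle n (p n)) (k n)) (uniform_mass n)"
  have transfer: "(\<integral>\<omega>. f (X n \<omega>) \<partial>M n) = measure_pmf.expectation (p n) f"
    if "n \<ge> 1" for n and f :: "nat \<Rightarrow> real"
    using integral_distr[OF assms(3)[OF that], of f] assms(4)[OF that] by simp
  have int: "integrable (p n) (\<lambda>m. ln (real m))" if "n \<ge> 1" for n
    using integrable_distr_eq[OF assms(3)[OF that], of "\<lambda>m. ln (real m)"] assms(4,5)[OF that] by simp
  have \<mu>: "\<mu> n = measure_pmf.expectation (p n) (\<lambda>m. ln (real m))" if "n \<ge> 1" for n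
    using assms(6)[OF that] transfer[OF that, of "\<lambda>m. ln (real m)"] by simp
  have tail: "(\<lambda>n. measure_pmf.expectation (p n)
      (\<lambda>m. ln (real m) * indicat_real {m. ln (real m) > \<eta> * ln (real n)} m)) \<in> o(\<mu>)"
    if "\<eta> > 0" for \<eta>
  proof (rule landau_o.small.in_cong[THEN iffD1, OF _ assms(9)[OF that]])
    show "\<forall>\<^sub>F n in sequentially. (\<integral>\<omega>. ln (real (X n \<omega>)) *
        indicat_real {\<omega>. ln (real (X n \<omega>)) > \<eta> * ln (real n)} \<omega> \<partial>M n) =
      measure_pmf.expectation (p n) (\<lambda>m. ln (real m) * indicat_real {m. ln (real m) > \<eta> * ln (real n)} m)"
      using eventually_ge_at_top[of 1]
    proof eventually_elim
      case (elim n)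
      show ?case by (subst transfer[OF elim, symmetric]) (simp add: indicator_def)
    qed
  qed
  show ?thesis
    unfolding tv_cutoff_def
  proof (intro conjI allI impI)
    show "\<forall>\<^sub>F n in sequentially. 0 < 3 * ln (real n) / (2 * \<mu> n)"
      using eventually_ge_at_top[of 2] by eventually_elim (use \<mu>_pos in auto)
  next
    fix \<epsilon> :: real and k :: "nat \<Rightarrow> nat"
    assume \<epsilon>: "0 < \<epsilon> \<and> \<epsilon> < 1"
      and k: "\<forall>\<^sub>F n in sequentially. (1 + \<epsilon>) * (3 * ln (real n) / (2 * \<mu> n)) < real (k n)"
    \<comment> \<open>By \<open>k\<close> the mean of \<open>ln Z\<close> is at least \<open>b * ln n\<close>, so \<open>Z\<close> exceeds \<open>n\<^sup>a\<close>, where \<open>a\<close> is still above \<open>3 / 2\<close>.\<close>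
    define a b where "a = 3 / 2 * (1 + \<epsilon> / 2)" and "b = 3 / 2 * (1 + \<epsilon>)"
    have ab: "0 < a" "a < b" "3 / 2 \<le> a" using \<epsilon> by (auto simp: a_def b_def)
    let ?u = "\<lambda>n. exp (- (3 / 4 * \<epsilon>) * ln (real n))"
    let ?Pr = "\<lambda>n. measure_pmf.prob (product_pmf (p n) (k n)) {m. ln (real m) \<le> a * ln (real n)}"
    have "\<forall>\<^sub>F n in sequentially. b * ln (real n) \<le> real (k n) * \<mu> n"
      using k eventually_ge_at_top[of 1]
    proof eventually_elim
      case (elim n)
      then show ?case using \<mu>_pos[of n] by (simp add: b_def field_simps)
    qed
    then have "?Pr \<longlonglongrightarrow> 0"
      by (intro product_pmf_lower_concentration[OF p int \<mu> \<mu>_pos tail ab(1,2)])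
    moreover have "?u \<longlonglongrightarrow> 0" using \<epsilon> by (intro tendsto_exp_neg_ln) simp
    ultimately have lim: "(\<lambda>n. ?Pr n + ?u n + 2 * (?u n)\<^sup>2) \<longlonglongrightarrow> 0 + 0 + 2 * 0\<^sup>2"
      by (intro tendsto_intros)
    show "?tv k \<longlonglongrightarrow> 0"
    proof (rule tendsto_sandwich[OF _ _ tendsto_const])
      show "(\<lambda>n. ?Pr n + ?u n + 2 * (?u n)\<^sup>2) \<longlonglongrightarrow> 0" using lim by simp
      show "\<forall>\<^sub>F n in sequentially. 0 \<le> ?tv k n"
        using eventually_ge_at_top[of 1] by eventually_elim (use p tv_norm_bounds in auto)
      show "\<forall>\<^sub>F n in sequentially. ?tv k n \<le> ?Pr n + ?u n + 2 * (?u n)\<^sup>2"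
        using eventually_ge_at_top[of 4]
      proof eventually_elim
        case (elim n)
        have n: "n \<ge> 1" "0 \<le> ln (real n)" using elim by auto
        let ?x = "a * ln (real n)"
        have "2 \<le> sqrt (real n)" using elim by (intro real_le_rsqrt) simp
        then have "2 * real n \<le> exp (3 / 2 * ln (real n))"
          using exp_three_halves_ln(1)[OF n(1)] by (simp add: mult.commute mult_left_mono)
        also have "\<dots> \<le> exp ?x" using ab(3) n by (intro iffD2[OF exp_le_cancel_iff] mult_right_mono)
        finally have x: "2 * real n \<le> exp ?x" .
        have u: "real n * sqrt (real n) / exp ?x = ?u n"
          unfolding exp_three_halves_ln(1)[OF n(1), symmetric] exp_diff[symmetric]
          by (simp add: a_def algebra_simps)
        have "real n ^ 3 / (exp ?x)\<^sup>2 = (real n * sqrt (real n) / exp ?x)\<^sup>2"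
          by (simp add: power_divide power_mult_distrib power2_eq_square power3_eq_cube)
        then show ?case using tv_norm_upper[OF p[OF n(1)] n(1) x, of "k n"] u by simp
      qed
    qed
  next
    fix \<epsilon> :: real and k :: "nat \<Rightarrow> nat"
    assume \<epsilon>: "0 < \<epsilon> \<and> \<epsilon> < 1"
      and k: "\<forall>\<^sub>F n in sequentially. real (k n) < (1 - \<epsilon>) * (3 * ln (real n) / (2 * \<mu> n))"
    \<comment> \<open>With at most \<open>1 / 2\<close> in place of \<open>\<epsilon>\<close>, the bound \<open>n\<^sup>b\<close> on the product is at least \<open>n\<close>.\<close>
    define \<epsilon>' where "\<epsilon>' = min \<epsilon> (1 / 2)"
    \<comment> \<open>Here the mean of \<open>ln Z\<close> is at most \<open>a * ln n\<close>, so \<open>Z\<close> is at most \<open>n\<^sup>b\<close>, where \<open>b\<close> is still below \<open>3 / 2\<close>.\<close>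
    define a b where "a = 3 / 2 * (1 - \<epsilon>')" and "b = 3 / 2 * (1 - \<epsilon>' / 2)"
    have \<epsilon>': "0 < \<epsilon>'" "\<epsilon>' \<le> \<epsilon>" "\<epsilon>' \<le> 1 / 2" using \<epsilon> by (auto simp: \<epsilon>'_def)
    have ab: "0 < a" "a < b" "1 \<le> b" using \<epsilon>' by (auto simp: a_def b_def)
    let ?v = "\<lambda>n. exp (- (3 / 2 * \<epsilon>') * ln (real n))"
    let ?Pr = "\<lambda>n. measure_pmf.prob (product_pmf (p n) (k n)) {m. ln (real m) > b * ln (real n)}"
    have "\<forall>\<^sub>F n in sequentially. real (k n) * \<mu> n \<le> a * ln (real n)"
      using k eventually_ge_at_top[of 1]
    proof eventually_elim
      case (elim n)
      then have "real (k n) * \<mu> n \<le> 3 / 2 * (1 - \<epsilon>) * ln (real n)"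
        using \<mu>_pos[of n] by (simp add: field_simps)
      also have "\<dots> \<le> a * ln (real n)"
        using \<epsilon>' elim by (intro mult_right_mono) (auto simp: a_def)
      finally show ?case .
    qed
    then have "?Pr \<longlonglongrightarrow> 0"
      by (intro product_pmf_upper_concentration[OF p int \<mu> \<mu>_pos tail ab(1,2)])
    moreover have "?v \<longlonglongrightarrow> 0" using \<epsilon>' by (intro tendsto_exp_neg_ln) simp
    ultimately have lim: "(\<lambda>n. 1 - ?Pr n - 37056 * ?v n) \<longlonglongrightarrow> 1 - 0 - 37056 * 0"
      by (intro tendsto_intros)
    show "?tv k \<longlonglongrightarrow> 1"
    proof (rule tendsto_sandwich[OF _ _ _ tendsto_const])
      show "(\<lambda>n. 1 - ?Pr n - 37056 * ?v n) \<longlonglongrightarrow> 1" using lim by simp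
      show "\<forall>\<^sub>F n in sequentially. ?tv k n \<le> 1"
        using eventually_ge_at_top[of 1] by eventually_elim (use p tv_norm_bounds in auto)
      show "\<forall>\<^sub>F n in sequentially. 1 - ?Pr n - 37056 * ?v n \<le> ?tv k n"
        using eventually_ge_at_top[of 2]
      proof eventually_elim
        case (elim n)
        have n: "n \<ge> 1" "0 \<le> ln (real n)" using elim by auto
        let ?x = "b * ln (real n)"
        have "exp (1 * ln (real n)) \<le> exp ?x"
          using ab(3) n by (intro iffD2[OF exp_le_cancel_iff] mult_right_mono)
        then have x: "real n \<le> exp ?x" using n by simp
        have "(exp ?x)\<^sup>2 = exp (2 * ?x)" by (simp add: exp_double)
        then have "(exp ?x)\<^sup>2 / real n ^ 3 = exp (2 * ?x - 3 * ln (real n))"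
          unfolding exp_three_halves_ln(2)[OF n(1), symmetric] by (simp add: exp_diff)
        also have "2 * ?x - 3 * ln (real n) = - (3 / 2 * \<epsilon>') * ln (real n)"
          by (simp add: b_def field_simps)
        finally show ?case using tv_norm_lower[OF p[OF n(1)] elim x, of "k n"] by simp
      qed
    qed
  qed
qed

end
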